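(* Let $d\ge1$ be an integer. Given real numbers $s,t$ with $0<t<s<1$, there exists a compact set $E\subset\mathbb{R}^d$ such that $\overline{\dim}_{\rm C}E=t$ and $\dim_{\rm P}E=s$.
   Context: $B(x,r)$ is the closed Euclidean ball with centre $x$ and radius $r$, and $|A|$ is the diameter of a set $A$. $\mathcal{P}(E)$ is the set of Borel probability measures on $\mathbb{R}^d$ supported by $E$, i.e. with $\mu(\mathbb{R}^d\setminus E)=0$. Upper correlation dimension: for a Borel probability measure $\mu$, $\overline{\dim}_{\rm C}\mu=\limsup_{r\to0}\frac{\log\int\mu(B(x,r))\,d\mu(x)}{\log r}$, and for a Borel set $E$, $\overline{\dim}_{\rm C}E=\sup_{\mu\in\mathcal{P}(E)}\overline{\dim}_{\rm C}\mu$. Packing dimension: a $\delta$-packing of $E$ is a finite or countable family of disjoint closed balls of radii at most $\delta$ with centres in $E$. For $s\ge0$, let $\mathcal{P}^s_\delta(E)=\sup\{\sum_i|B_i|^s:\{B_i\}\text{ a }\delta\text{-packing of }E\}$, $\mathcal{P}^s_0(E)=\inf_{\delta>0}\mathcal{P}^s_\delta(E)$ and $\mathcal{P}^s(E)=\inf\{\sum_{i=1}^\infty\mathcal{P}^s_0(E_i):E\subset\bigcup_{i=1}^\infty E_i\}$. Then $\dim_{\rm P}E=\inf\{s\ge0:\mathcal{P}^s(E)=0\}$. *)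

theory Defs
  imports "HOL-Probability.Probability"
begin

subsection \<open>Upper correlation dimension\<close>

text \<open>Meaningful for Borel sets \<open>E\<close> only: \<^const>\<open>emeasure\<close> is \<open>0\<close> on every
  non-measurable set.\<close>

definition prob_measures_on :: "'a::euclidean_space set \<Rightarrow> 'a measure set" where
  "prob_measures_on E = {\<mu>. prob_space \<mu> \<and> sets \<mu> = sets borel \<and> emeasure \<mu> (UNIV - E) = 0}"

text \<open>For a Borel probability measure the integrand is Borel measurable with values in \<open>[0, 1]\<close>,
  and for \<open>r > 0\<close> the integral is positive, so neither the default value of the Bochner integral
  nor that of \<^term>\<open>ln 0\<close> is ever used.\<close>

definition upper_corr_dim_measure :: "'a::euclidean_space measure \<Rightarrow> ereal" where
  "upper_corr_dim_measure \<mu> =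
     Limsup (at_right (0::real))
       (\<lambda>r. ereal (ln (\<integral>x. measure \<mu> (cball x r) \<partial>\<mu>) / ln r))"

text \<open>The supremum is taken in \<^typ>\<open>ereal\<close>, so the empty set gets the value \<open>-\<infinity>\<close>.\<close>

definition upper_corr_dim :: "'a::euclidean_space set \<Rightarrow> ereal" where
  "upper_corr_dim E = (SUP \<mu>\<in>prob_measures_on E. upper_corr_dim_measure \<mu>)"


subsection \<open>Packing dimension\<close>

text \<open>A packing is represented by the set of its balls; this loses nothing compared with indexed
  families, as disjoint nonempty balls are distinct. Balls are non-degenerate (positive radius).
  The empty packing is allowed.\<close>

definition packings :: "real \<Rightarrow> 'a::euclidean_space set \<Rightarrow> 'a set set set" where
  "packings \<delta> E =
     {\<B>. countable \<B> \<and> disjoint \<B> \<and> (\<forall>B\<in>\<B>. \<exists>x\<in>E. \<exists>r. 0 < r \<and> r \<le> \<delta> \<and> B = cball x r)}"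

definition packing_pre_delta :: "real \<Rightarrow> real \<Rightarrow> 'a::euclidean_space set \<Rightarrow> ennreal" where
  "packing_pre_delta s \<delta> E =
     (SUP \<B>\<in>packings \<delta> E. \<Sum>\<^sub>\<infinity>B\<in>\<B>. ennreal (diameter B powr s))"

definition packing_premeasure :: "real \<Rightarrow> 'a::euclidean_space set \<Rightarrow> ennreal" where
  "packing_premeasure s E = (INF \<delta>\<in>{0<..}. packing_pre_delta s \<delta> E)"

definition packing_measure :: "real \<Rightarrow> 'a::euclidean_space set \<Rightarrow> ennreal" where
  "packing_measure s E =
     (INF A\<in>{A :: nat \<Rightarrow> 'a set. E \<subseteq> (\<Union>i. A i)}. \<Sum>i. packing_premeasure s (A i))"

definition packing_dim :: "'a::euclidean_space set \<Rightarrow> ereal" where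
  "packing_dim E = Inf {ereal s | s. 0 \<le> s \<and> packing_measure s E = 0}"

end

theory Submission
  imports Defs
begin

text \<open>The set is coded by binary sequences, written as sets of natural numbers: with
\<open>\<rho> = 2 powr (-1/s) < 1/2\<close> the sequence \<open>a\<close> is sent to \<open>\<Sum>k\<in>a. \<rho>^k\<close> on a line. Sequences that
first differ at position \<open>n\<close> go to points whose distance is comparable to \<open>\<rho>^n\<close>, and
\<open>\<rho> powr s = 1/2\<close>, so a family of sequences with about \<open>2^(\<theta> n)\<close> prefixes of length \<open>n\<close> has
dimension \<open>\<theta> s\<close> at the scale \<open>\<rho>^n\<close>. All sequences together give dimension \<open>s\<close>. The ones
supported by a set \<open>S\<close> of positions of density \<open>\<theta> = t/s\<close> give dimension \<open>t\<close>.

The two dimensions differ because the packing dimension needs only that each piece of the set is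
large at some small scales, which may depend on the piece, whereas the correlation integral tests
a measure everywhere at one common scale. So \<open>code_set S\<close> allows, besides the positions in \<open>S\<close>,
the positions in the window \<open>{m!..<(m+1)!}\<close>, but only to sequences marked by \<open>m\<close>. Each sequence is
marked by infinitely many \<open>m\<close>, while the sequences marked by one \<open>m\<close> share a prefix whose length
tends to infinity with \<open>m\<close>.

Packing dimension. If the packing measure of exponent \<open>u\<close> vanishes, Baire's theorem gives a set of
finite premeasure that is dense in a ball of the coded set. This ball contains all points whose
sequences agree with that of its centre below \<open>m!\<close>, for every large \<open>m\<close> marking it; they have \<open>2^((m+1)! - m!)\<close>
prefixes of length \<open>(m+1)!\<close>, and as \<open>m!\<close> is negligible against \<open>(m+1)!\<close> these produce packings of
unbounded weight unless \<open>u \<ge> s\<close> (\<open>packing_premeasure_dense_infinite\<close>). The upper bound \<open>s\<close> is the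
mass distribution principle for the fair coin measure on all positions (\<open>packing_measure_eq_0\<close>).

Correlation dimension. Either the correlation integrals of a measure stay away from \<open>0\<close>, and its
dimension is at most \<open>0\<close>, or they tend to \<open>0\<close>, and then so do the masses of sets of shrinking diameter,
in particular of the sequences marked by \<open>m\<close>. In the second case let \<open>(j+1)! \<le> n < (j+2)!\<close>. At least
half of the mass lies on sequences marked by neither \<open>j\<close> nor \<open>j+1\<close>, whose prefixes of length \<open>n\<close> are free
only below \<open>j! \<le> n/(j+1)\<close> and in \<open>S\<close>. There are few of these prefixes, and the Cauchy-Schwarz
inequality bounds the correlation integral at scale \<open>\<rho>^n\<close> from below by nearly \<open>\<rho>^(n t)\<close>
(\<open>upper_corr_dim_measure_code_set_le\<close>). The value \<open>t\<close> is attained by fair coins on the positions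
in \<open>S\<close> (\<open>upper_corr_dim_measure_coin_ge\<close>).\<close>

section \<open>Correlation integrals\<close>

abbreviation corr_integral :: "'a::euclidean_space measure \<Rightarrow> real \<Rightarrow> real" where
  "corr_integral \<mu> r \<equiv> \<integral>x. measure \<mu> (cball x r) \<partial>\<mu>"

text \<open>The balls are the sections of the closed set of pairs at distance at most \<open>r\<close>, so this is
measurability of section measures.\<close>

lemma borel_measurable_measure_cball:
  fixes \<mu> :: "'a::euclidean_space measure"
  assumes "prob_space \<mu>" and [measurable_cong]: "sets \<mu> = sets borel"
  shows "(\<lambda>x. measure \<mu> (cball x r)) \<in> borel_measurable \<mu>"
proof -
  interpret prob_space \<mu> by fact
  have "(\<lambda>x. emeasure \<mu> (Pair x -` {z \<in> space (\<mu> \<Otimes>\<^sub>M \<mu>). dist (fst z) (snd z) \<le> r})) \<in> borel_measurable \<mu>"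
    by (rule measurable_emeasure_Pair) measurable
  moreover have "Pair x -` {z \<in> space (\<mu> \<Otimes>\<^sub>M \<mu>). dist (fst z) (snd z) \<le> r} = cball x r" for x
    using sets_eq_imp_space_eq[OF assms(2)] by (auto simp: space_pair_measure)
  ultimately show ?thesis unfolding measure_def by simp
qed

lemma integrable_measure_cball:
  fixes \<mu> :: "'a::euclidean_space measure"
  assumes "prob_space \<mu>" "sets \<mu> = sets borel"
  shows "integrable \<mu> (\<lambda>x. measure \<mu> (cball x r))"
proof -
  interpret prob_space \<mu> by fact
  show ?thesis
    by (rule integrable_const_bound[where B=1])
      (auto simp: borel_measurable_measure_cball[OF assms])
qed

lemma corr_integral_mono:
  fixes \<mu> :: "'a::euclidean_space measure"
  assumes "prob_space \<mu>" "sets \<mu> = sets borel" "r \<le> r'"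
  shows "corr_integral \<mu> r \<le> corr_integral \<mu> r'"
proof -
  interpret prob_space \<mu> by fact
  show ?thesis
    by (intro integral_mono integrable_measure_cball assms finite_measure_mono)
      (use assms in \<open>auto simp: subset_eq\<close>)
qed

text \<open>A ball of radius \<open>r\<close> around a point of a piece of diameter at most \<open>r\<close> contains that piece.\<close>

lemma corr_integral_ge_squares:
  fixes \<mu> :: "'a::euclidean_space measure" and Q :: "'b \<Rightarrow> 'a set"
  assumes "prob_space \<mu>" "sets \<mu> = sets borel" "finite W" "disjoint_family_on Q W"
    and meas: "\<And>w. w \<in> W \<Longrightarrow> Q w \<in> sets borel"
    and diam: "\<And>w x y. w \<in> W \<Longrightarrow> x \<in> Q w \<Longrightarrow> y \<in> Q w \<Longrightarrow> dist x y \<le> r"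
  shows "(\<Sum>w\<in>W. measure \<mu> (Q w)^2) \<le> corr_integral \<mu> r"
proof -
  interpret prob_space \<mu> by fact
  have meas': "w \<in> W \<Longrightarrow> Q w \<in> sets \<mu>" for w using meas assms by auto
  have "(\<Sum>w\<in>W. measure \<mu> (Q w)^2) = (\<Sum>w\<in>W. \<integral>x. measure \<mu> (Q w) * indicator (Q w) x \<partial>\<mu>)"
    by (intro sum.cong) (auto simp: power2_eq_square meas')
  also have "\<dots> = (\<integral>x. (\<Sum>w\<in>W. measure \<mu> (Q w) * indicator (Q w) x) \<partial>\<mu>)"
    by (subst Bochner_Integration.integral_sum) (auto simp: meas' emeasure_eq_measure)
  also have "\<dots> \<le> corr_integral \<mu> r"
  proof (rule integral_mono)
    show "integrable \<mu> (\<lambda>x. \<Sum>w\<in>W. measure \<mu> (Q w) * indicator (Q w) x)"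
      by (auto simp: meas' emeasure_eq_measure)
    show "integrable \<mu> (\<lambda>x. measure \<mu> (cball x r))"
      by (rule integrable_measure_cball) fact+
    fix x
    show "(\<Sum>w\<in>W. measure \<mu> (Q w) * indicator (Q w) x) \<le> measure \<mu> (cball x r)"
    proof (cases "\<exists>v\<in>W. x \<in> Q v")
      case True
      then obtain v where v: "v \<in> W" "x \<in> Q v" by auto
      have "(\<Sum>w\<in>W. measure \<mu> (Q w) * indicator (Q w) x)
          = (\<Sum>w\<in>W. if w = v then measure \<mu> (Q v) else 0)"
        using v assms(4) by (intro sum.cong) (auto simp: disjoint_family_on_def indicator_def)
      also have "\<dots> = measure \<mu> (Q v)" using v assms(3) by simp
      also have "\<dots> \<le> measure \<mu> (cball x r)"
        using v diam assms(2) by (intro finite_measure_mono) auto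
      finally show ?thesis .
    next
      case False
      then have "(\<Sum>w\<in>W. measure \<mu> (Q w) * indicator (Q w) x) = 0"
        by (intro sum.neutral) (auto simp: indicator_def)
      then show ?thesis by simp
    qed
  qed
  finally show ?thesis .
qed

text \<open>The Cauchy-Schwarz inequality turns the sum of squares into the square of the total mass: a set
covered by few small pieces forces a large correlation integral.\<close>

lemma corr_integral_ge_pieces:
  fixes \<mu> :: "'a::euclidean_space measure" and Q :: "'b \<Rightarrow> 'a set"
  assumes "prob_space \<mu>" "sets \<mu> = sets borel" "finite W" "disjoint_family_on Q W"
    and meas: "\<And>w. w \<in> W \<Longrightarrow> Q w \<in> sets borel"
    and diam: "\<And>w x y. w \<in> W \<Longrightarrow> x \<in> Q w \<Longrightarrow> y \<in> Q w \<Longrightarrow> dist x y \<le> r"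
  shows "measure \<mu> (\<Union>w\<in>W. Q w)^2 \<le> card W * corr_integral \<mu> r"
proof -
  interpret prob_space \<mu> by fact
  have "measure \<mu> (\<Union>w\<in>W. Q w) = (\<Sum>w\<in>W. measure \<mu> (Q w))"
    using assms by (intro finite_measure_finite_Union) auto
  also have "\<dots>^2 \<le> card W * (\<Sum>w\<in>W. measure \<mu> (Q w)^2)"
    using Cauchy_Schwarz_ineq_sum[of "\<lambda>_. 1::real" "\<lambda>w. measure \<mu> (Q w)" W] by simp
  also have "\<dots> \<le> card W * corr_integral \<mu> r"
    by (intro mult_left_mono corr_integral_ge_squares assms) auto
  finally show ?thesis .
qed

lemma tendsto_ln_powr_quotient:
  fixes K v :: real
  shows "((\<lambda>r. ln K / ln r + v) \<longlongrightarrow> v) (at_right 0)"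
proof -
  have "((\<lambda>r. ln K / ln r) \<longlongrightarrow> 0) (at_right (0::real))"
    by (rule tendsto_divide_0[OF tendsto_const filterlim_at_bot_imp_at_infinity[OF ln_at_0]])
  from tendsto_add[OF this tendsto_const[of v]] show ?thesis by simp
qed

text \<open>Dividing by \<open>ln r < 0\<close> reverses the inequality, and the constant disappears in the limit.\<close>

lemma upper_corr_dim_measure_le:
  assumes "0 < K" and bd: "\<forall>\<^sub>F r in at_right 0. K * r powr v \<le> corr_integral \<mu> r"
  shows "upper_corr_dim_measure \<mu> \<le> ereal v"
proof -
  have "\<forall>\<^sub>F r in at_right (0::real). r \<in> {0<..<1}" by (rule eventually_at_right_real) simp
  with bd have "\<forall>\<^sub>F r in at_right 0. ereal (ln (corr_integral \<mu> r) / ln r) \<le> ereal (ln K / ln r + v)"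
  proof eventually_elim
    case (elim r)
    have "ln K + v * ln r = ln (K * r powr v)"
      using elim assms(1) by (simp add: ln_mult ln_powr)
    also have "\<dots> \<le> ln (corr_integral \<mu> r)"
      using elim assms(1) by (intro ln_mono) auto
    finally have "ln (corr_integral \<mu> r) / ln r \<le> (ln K + v * ln r) / ln r"
      using elim by (intro divide_right_mono_neg) auto
    with elim show ?case by (simp add: add_divide_distrib)
  qed
  then have "upper_corr_dim_measure \<mu> \<le> Limsup (at_right 0) (\<lambda>r. ereal (ln K / ln r + v))"
    unfolding upper_corr_dim_measure_def by (rule Limsup_mono)
  also have "\<dots> = ereal v"
    by (intro lim_imp_Limsup tendsto_intros tendsto_ln_powr_quotient) simp
  finally show ?thesis .
qed

lemma upper_corr_dim_measure_ge:
  assumes "0 < K"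
    and bd: "\<forall>\<^sub>F r in at_right 0. 0 < corr_integral \<mu> r \<and> corr_integral \<mu> r \<le> K * r powr v"
  shows "ereal v \<le> upper_corr_dim_measure \<mu>"
proof -
  have "\<forall>\<^sub>F r in at_right (0::real). r \<in> {0<..<1}" by (rule eventually_at_right_real) simp
  with bd have ev: "\<forall>\<^sub>F r in at_right 0. ereal (ln K / ln r + v) \<le> ereal (ln (corr_integral \<mu> r) / ln r)"
  proof eventually_elim
    case (elim r)
    have "ln (corr_integral \<mu> r) \<le> ln (K * r powr v)"
      using elim assms(1) by (intro ln_mono) auto
    also have "\<dots> = ln K + v * ln r"
      using elim assms(1) by (simp add: ln_mult ln_powr)
    finally have "(ln K + v * ln r) / ln r \<le> ln (corr_integral \<mu> r) / ln r"
      using elim by (intro divide_right_mono_neg) auto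
    with elim show ?case by (simp add: add_divide_distrib)
  qed
  have "ereal v = Limsup (at_right 0) (\<lambda>r. ereal (ln K / ln r + v))"
    by (rule sym, intro lim_imp_Limsup tendsto_intros tendsto_ln_powr_quotient) simp
  also have "\<dots> \<le> upper_corr_dim_measure \<mu>"
    unfolding upper_corr_dim_measure_def by (rule Limsup_mono[OF ev])
  finally show ?thesis .
qed

section \<open>Packing measures\<close>

text \<open>The mass distribution principle for packings: the balls are disjoint, so their masses add up to at
most the total mass, and the excess exponent \<open>u - s\<close> leaves a power of \<open>\<delta>\<close> to spare.\<close>

lemma packing_pre_delta_le:
  fixes \<nu> :: "'a::euclidean_space measure"
  assumes "finite_measure \<nu>" "sets \<nu> = sets borel" "0 < c" "0 \<le> s" "s \<le> u" "\<delta> \<le> 1"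
    and mass: "\<And>x r. x \<in> E \<Longrightarrow> 0 < r \<Longrightarrow> r \<le> 1 \<Longrightarrow> c * r powr s \<le> measure \<nu> (cball x r)"
  shows "packing_pre_delta u \<delta> E \<le> ennreal (2 powr u * \<delta> powr (u - s) * measure \<nu> UNIV / c)"
  unfolding packing_pre_delta_def
proof (rule SUP_least)
  interpret finite_measure \<nu> by fact
  fix \<B> :: "'a set set" assume B: "\<B> \<in> packings \<delta> E"
  show "(\<Sum>\<^sub>\<infinity>B\<in>\<B>. ennreal (diameter B powr u)) \<le> ennreal (2 powr u * \<delta> powr (u - s) * measure \<nu> UNIV / c)"
    unfolding nonneg_infsum_complete[OF zero_le]
  proof (rule SUP_least)
    fix F assume F: "F \<in> {F. finite F \<and> F \<subseteq> \<B>}"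
    have one: "diameter B powr u \<le> 2 powr u * \<delta> powr (u - s) / c * measure \<nu> B" if "B \<in> F" for B
    proof -
      obtain x r where xr: "x \<in> E" "0 < r" "r \<le> \<delta>" "B = cball x r"
        using F B \<open>B \<in> F\<close> unfolding packings_def by blast
      have "diameter B powr u = 2 powr u * (r powr (u - s) * r powr s)"
        using xr by (simp add: powr_mult flip: powr_add)
      also have "\<dots> \<le> 2 powr u * (\<delta> powr (u - s) * (measure \<nu> B / c))"
        using xr mass[of x r] assms
        by (intro mult_left_mono mult_mono powr_mono2) (auto simp: field_simps)
      finally show ?thesis by (simp add: field_simps)
    qed
    have meas: "F \<subseteq> sets \<nu>"
      using F B assms(2) unfolding packings_def by fastforce
    have dis: "disjoint_family_on (\<lambda>B. B) F"
      using F B unfolding packings_def disjoint_family_on_def disjoint_def by blast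
    have "(\<Sum>B\<in>F. diameter B powr u) \<le> (\<Sum>B\<in>F. 2 powr u * \<delta> powr (u - s) / c * measure \<nu> B)"
      by (rule sum_mono[OF one])
    also have "\<dots> = 2 powr u * \<delta> powr (u - s) / c * (\<Sum>B\<in>F. measure \<nu> B)"
      by (simp add: sum_distrib_left)
    also have "(\<Sum>B\<in>F. measure \<nu> B) = measure \<nu> (\<Union>B\<in>F. B)"
      using F meas dis by (intro finite_measure_finite_Union[symmetric]) auto
    also have "2 powr u * \<delta> powr (u - s) / c * measure \<nu> (\<Union>B\<in>F. B)
        \<le> 2 powr u * \<delta> powr (u - s) / c * measure \<nu> UNIV"
      using assms(2,3) by (intro mult_left_mono finite_measure_mono) auto
    finally have "(\<Sum>B\<in>F. diameter B powr u) \<le> 2 powr u * \<delta> powr (u - s) * measure \<nu> UNIV / c"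
      by simp
    then show "(\<Sum>B\<in>F. ennreal (diameter B powr u)) \<le> ennreal (2 powr u * \<delta> powr (u - s) * measure \<nu> UNIV / c)"
      by (subst sum_ennreal) (auto intro: ennreal_leI)
  qed
qed

lemma packing_measure_eq_0:
  fixes \<nu> :: "'a::euclidean_space measure"
  assumes "finite_measure \<nu>" "sets \<nu> = sets borel" "0 < c" "0 \<le> s" "s < u"
    and mass: "\<And>x r. x \<in> E \<Longrightarrow> 0 < r \<Longrightarrow> r \<le> 1 \<Longrightarrow> c * r powr s \<le> measure \<nu> (cball x r)"
  shows "packing_measure u E = 0"
proof -
  define M where "M = 2 powr u * measure \<nu> UNIV / c"
  have zero: "packing_premeasure u E' = 0" if "E' \<subseteq> E" for E'
  proof -
    have "((\<lambda>\<delta>. ennreal (M * \<delta> powr (u - s))) \<longlongrightarrow> ennreal (M * 0)) (at_right 0)"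
      using assms(5)
      by (intro tendsto_ennrealI tendsto_mult_left tendsto_zero_powrI[where b="u - s"] tendsto_ident_at tendsto_const)
        (auto simp: eventually_at_filter)
    moreover have "\<forall>\<^sub>F \<delta> in at_right 0. packing_premeasure u E' \<le> ennreal (M * \<delta> powr (u - s))"
    proof -
      have "\<forall>\<^sub>F r in at_right (0::real). r \<in> {0<..<1}" by (rule eventually_at_right_real) simp
      then show ?thesis
      proof eventually_elim
        case (elim \<delta>)
        have "packing_premeasure u E' \<le> packing_pre_delta u \<delta> E'"
          unfolding packing_premeasure_def using elim by (intro INF_lower) auto
        also have "\<dots> \<le> ennreal (M * \<delta> powr (u - s))"
          unfolding M_def using packing_pre_delta_le[OF assms(1-4), of u \<delta> E'] elim assms(5) mass that
          by (simp add: mult_ac subset_eq)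
        finally show ?case .
      qed
    qed
    ultimately have "packing_premeasure u E' \<le> ennreal (M * 0)"
      by (intro tendsto_lowerbound) auto
    then show ?thesis by simp
  qed
  have "packing_measure u E \<le> (\<Sum>i. packing_premeasure u (if i = (0::nat) then E else {}))"
    unfolding packing_measure_def by (rule INF_lower) (auto intro!: exI[of _ 0])
  also have "\<dots> = 0" by (simp add: zero)
  finally show ?thesis by simp
qed

lemma packing_pre_delta_ge:
  fixes y :: "'b \<Rightarrow> 'a::euclidean_space"
  assumes "finite W" "y ` W \<subseteq> F" "0 < r" "r \<le> \<delta>"
    and far: "\<And>v w. v \<in> W \<Longrightarrow> w \<in> W \<Longrightarrow> v \<noteq> w \<Longrightarrow> 2 * r < dist (y v) (y w)"
  shows "ennreal (card W * (2 * r) powr u) \<le> packing_pre_delta u \<delta> F"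
proof -
  define B where "B w = cball (y w) r" for w
  have dis: "B v \<inter> B w = {}" if "v \<in> W" "w \<in> W" "v \<noteq> w" for v w
  proof -
    have False if "z \<in> B v" "z \<in> B w" for z
      using that far[OF \<open>v \<in> W\<close> \<open>w \<in> W\<close> \<open>v \<noteq> w\<close>] dist_triangle2[of "y v" "y w" z]
      by (auto simp: B_def dist_commute)
    then show ?thesis by blast
  qed
  have ne: "B w \<noteq> {}" for w using assms(3) by (simp add: B_def)
  have inj: "inj_on B W" using dis ne by (metis (no_types) inf.idem inj_onI)
  have pack: "B ` W \<in> packings \<delta> F"
    unfolding packings_def
  proof (intro CollectI conjI ballI)
    show "countable (B ` W)" using assms(1) by (intro countable_finite) simp
    show "disjoint (B ` W)" unfolding disjoint_def using dis by blast
    fix b assume "b \<in> B ` W"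
    then show "\<exists>x\<in>F. \<exists>r'. 0 < r' \<and> r' \<le> \<delta> \<and> b = cball x r'"
      using assms(2-4) unfolding B_def by blast
  qed
  have "ennreal (card W * (2 * r) powr u) = (\<Sum>w\<in>W. ennreal (diameter (B w) powr u))"
    using assms(3) by (simp add: B_def ennreal_mult ennreal_of_nat_eq_real_of_nat)
  also have "\<dots> = (\<Sum>b\<in>B ` W. ennreal (diameter b powr u))"
    by (simp add: sum.reindex[OF inj])
  also have "\<dots> = (\<Sum>\<^sub>\<infinity>b\<in>B ` W. ennreal (diameter b powr u))"
    using assms(1) by simp
  also have "\<dots> \<le> packing_pre_delta u \<delta> F"
    unfolding packing_pre_delta_def by (rule SUP_upper[OF pack])
  finally show ?thesis .
qed

text \<open>Vanishing of the packing measure gives a countable cover by sets of finite premeasure. By Baire's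
theorem their closures cannot all have empty interior relative to \<open>E\<close>. Closures are harmless here,
as centres of packing balls may be moved slightly.\<close>

lemma locally_dense_piece_of_packing_null:
  fixes E :: "'a::euclidean_space set"
  assumes "compact E" "E \<noteq> {}" "packing_measure u E = 0"
  obtains F x e where "packing_premeasure u F < \<infinity>" "x \<in> E" "0 < e" "E \<inter> ball x e \<subseteq> closure F"
proof -
  have "(INF A\<in>{A :: nat \<Rightarrow> 'a set. E \<subseteq> (\<Union>i. A i)}. \<Sum>i. packing_premeasure u (A i)) < 1"
    using assms(3) unfolding packing_measure_def by simp
  then obtain A :: "nat \<Rightarrow> 'a set" where A: "E \<subseteq> (\<Union>i. A i)" "(\<Sum>i. packing_premeasure u (A i)) < 1"
    unfolding INF_less_iff by auto
  have fin: "packing_premeasure u (A i) < \<infinity>" for i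
  proof -
    have "packing_premeasure u (A i) \<le> (\<Sum>i. packing_premeasure u (A i))"
      using sum_le_suminf[OF summableI, of "{i}" "\<lambda>i. packing_premeasure u (A i)"] by simp
    also have "\<dots> < 1" by fact
    also have "\<dots> < \<infinity>" by simp
    finally show ?thesis .
  qed
  let ?\<G> = "range (\<lambda>i. E - closure (A i))"
  have "E \<subseteq> (\<Union>i. closure (A i))"
  proof
    fix x assume "x \<in> E"
    then obtain i where "x \<in> A i" using A(1) by blast
    then show "x \<in> (\<Union>i. closure (A i))" using closure_subset[of "A i"] by blast
  qed
  then have empty: "\<Inter>?\<G> = {}" by blast
  have "\<not> E \<subseteq> closure (\<Inter>?\<G>)"
    unfolding empty closure_empty using assms(2) by blast
  moreover have "openin (top_of_set E) (E - closure (A i))" for i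
    using openin_open_Int[of "- closure (A i)" E] by (simp add: Diff_eq open_Compl)
  ultimately have "\<exists>i. \<not> E \<subseteq> closure (E - closure (A i))"
    using Baire[of E ?\<G>] compact_imp_closed[OF assms(1)] by blast
  then obtain i x where x: "x \<in> E" "x \<notin> closure (E - closure (A i))" by auto
  then obtain e where e: "0 < e" "\<And>y. y \<in> E - closure (A i) \<Longrightarrow> \<not> dist y x < e"
    by (auto simp: closure_approachable)
  show ?thesis
  proof (rule that[OF fin x(1) e(1)])
    show "E \<inter> ball x e \<subseteq> closure (A i)"
    proof
      fix y assume "y \<in> E \<inter> ball x e"
      then show "y \<in> closure (A i)" using e(2)[of y] by (auto simp: dist_commute)
    qed
  qed
qed

section \<open>Cantor sets coded by binary sequences\<close>

definition cantor_value :: "real \<Rightarrow> nat set \<Rightarrow> real" where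
  "cantor_value \<rho> a = (\<Sum>k. if k \<in> a then \<rho> ^ k else 0)"

text \<open>Any unit vector would do; the construction takes place on a line.\<close>

definition cantor_point :: "real \<Rightarrow> nat set \<Rightarrow> 'a::euclidean_space" where
  "cantor_point \<rho> a = cantor_value \<rho> a *\<^sub>R (SOME b. b \<in> Basis)"

text \<open>The sets that are closed in the product topology on binary sequences, stated with prefixes so that
compactness of the coded sets needs no topology on sequences.\<close>

definition prefix_closed :: "nat set set \<Rightarrow> bool" where
  "prefix_closed A \<longleftrightarrow> (\<forall>b. (\<forall>n. \<exists>a\<in>A. a \<inter> {..<n} = b \<inter> {..<n}) \<longrightarrow> b \<in> A)"

lemma prefix_eq_mono:
  fixes a b :: "nat set"
  assumes "a \<inter> {..<n} = b \<inter> {..<n}" "m \<le> n"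
  shows "a \<inter> {..<m} = b \<inter> {..<m}"
proof -
  have "c \<inter> {..<m} = c \<inter> {..<n} \<inter> {..<m}" for c :: "nat set" using assms(2) by auto
  then show ?thesis using assms(1) by metis
qed

text \<open>A condition on the first \<open>n\<close> positions is clopen.\<close>

lemma prefix_closed_Int:
  assumes A: "prefix_closed A" and D: "\<And>a b. a \<in> D \<Longrightarrow> a \<inter> {..<n} = b \<inter> {..<n} \<Longrightarrow> b \<in> D"
  shows "prefix_closed (A \<inter> D)"
  unfolding prefix_closed_def
proof (intro allI impI IntI)
  fix b assume b: "\<forall>n. \<exists>a\<in>A \<inter> D. a \<inter> {..<n} = b \<inter> {..<n}"
  show "b \<in> D" using b[rule_format, of n] D by blast
  have "\<exists>a\<in>A. a \<inter> {..<i} = b \<inter> {..<i}" for i using b[rule_format, of i] by blast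
  then show "b \<in> A" by (rule A[unfolded prefix_closed_def, rule_format])
qed

locale cantor_ratio =
  fixes \<rho> :: real
  assumes rho: "0 < \<rho>" "\<rho> < 1/2"
begin

definition sep :: real where "sep = (1 - 2 * \<rho>) / (1 - \<rho>)"
definition spread :: real where "spread = 1 / (1 - \<rho>)"

lemma sep_pos: "0 < sep" and spread_pos: "0 < spread"
  using rho by (auto simp: sep_def spread_def)

lemma summable_digits: "summable (\<lambda>k. if k \<in> a then \<rho> ^ k else 0)"
  by (rule summable_comparison_test'[of "\<lambda>k. \<rho> ^ k" 0]) (use rho in \<open>auto intro: summable_geometric\<close>)

lemma cantor_value_split:
  "cantor_value \<rho> a = (\<Sum>k<n. if k \<in> a then \<rho> ^ k else 0) + (\<Sum>k. if k + n \<in> a then \<rho> ^ (k + n) else 0)"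
  unfolding cantor_value_def using suminf_split_initial_segment[OF summable_digits[of a], of n] by simp

lemma cantor_tail:
  "0 \<le> (\<Sum>k. if k + n \<in> a then \<rho> ^ (k + n) else 0)"
  "(\<Sum>k. if k + n \<in> a then \<rho> ^ (k + n) else 0) \<le> spread * \<rho> ^ n"
proof -
  have sm: "summable (\<lambda>k. if k + n \<in> a then \<rho> ^ (k + n) else 0)"
    using summable_ignore_initial_segment[OF summable_digits[of a], of n] by simp
  show "0 \<le> (\<Sum>k. if k + n \<in> a then \<rho> ^ (k + n) else 0)"
    by (rule suminf_nonneg[OF sm]) (use rho in auto)
  have g: "(\<lambda>k. \<rho> ^ (k + n)) sums (spread * \<rho> ^ n)"
    using sums_mult2[OF geometric_sums, of \<rho> "\<rho> ^ n"] rho by (simp add: power_add spread_def)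
  show "(\<Sum>k. if k + n \<in> a then \<rho> ^ (k + n) else 0) \<le> spread * \<rho> ^ n"
    unfolding sums_unique[OF g] by (rule suminf_le[OF _ sm sums_summable[OF g]]) (use rho in auto)
qed

lemma dist_cantor_point:
  "dist (cantor_point \<rho> a :: 'a::euclidean_space) (cantor_point \<rho> b) = \<bar>cantor_value \<rho> a - cantor_value \<rho> b\<bar>"
proof -
  have "(SOME b. b \<in> Basis) \<in> (Basis :: 'a set)" by (rule someI_ex) (use nonempty_Basis in blast)
  then show ?thesis
    unfolding cantor_point_def dist_norm by (simp flip: scaleR_left_diff_distrib)
qed

lemma dist_cantor_point_le:
  assumes "a \<inter> {..<n} = b \<inter> {..<n}"
  shows "dist (cantor_point \<rho> a :: 'a::euclidean_space) (cantor_point \<rho> b) \<le> spread * \<rho> ^ n"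
proof -
  have "(\<Sum>k<n. if k \<in> a then \<rho> ^ k else 0) = (\<Sum>k<n. if k \<in> b then \<rho> ^ k else 0)"
    by (intro sum.cong) (use assms in auto)
  then show ?thesis
    using cantor_value_split[of a n] cantor_value_split[of b n] cantor_tail[of n a] cantor_tail[of n b]
    unfolding dist_cantor_point by linarith
qed

text \<open>The position \<open>k\<close> contributes \<open>\<rho>^k\<close>, and all later positions together at most
\<open>\<rho>^(k+1) / (1 - \<rho>)\<close>, which is smaller as \<open>\<rho> < 1/2\<close>.\<close>

lemma cantor_value_gap:
  assumes eq: "a \<inter> {..<k} = b \<inter> {..<k}" and k: "k \<in> a" "k \<notin> b"
  shows "sep * \<rho> ^ k \<le> cantor_value \<rho> a - cantor_value \<rho> b"
proof -
  have "(\<Sum>i<k. if i \<in> a then \<rho> ^ i else 0) = (\<Sum>i<k. if i \<in> b then \<rho> ^ i else 0)"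
    by (intro sum.cong) (use eq in auto)
  then have "\<rho> ^ k - spread * \<rho> ^ Suc k \<le> cantor_value \<rho> a - cantor_value \<rho> b"
    using cantor_value_split[of a "Suc k"] cantor_value_split[of b "Suc k"]
      cantor_tail[of "Suc k" a] cantor_tail[of "Suc k" b] k by simp
  moreover have "\<rho> ^ k - spread * \<rho> ^ Suc k = sep * \<rho> ^ k"
    using rho by (simp add: spread_def sep_def field_simps)
  ultimately show ?thesis by simp
qed

lemma dist_cantor_point_ge:
  assumes "a \<inter> {..<n} \<noteq> b \<inter> {..<n}"
  shows "sep * \<rho> ^ n \<le> dist (cantor_point \<rho> a :: 'a::euclidean_space) (cantor_point \<rho> b)"
proof -
  define k where "k = (LEAST k. (k \<in> a) \<noteq> (k \<in> b))"
  have ex: "\<exists>k<n. (k \<in> a) \<noteq> (k \<in> b)" using assms by auto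
  then have k: "(k \<in> a) \<noteq> (k \<in> b)"
    unfolding k_def by (intro LeastI_ex[of "\<lambda>k. (k \<in> a) \<noteq> (k \<in> b)"]) blast
  have less: "(i \<in> a) = (i \<in> b)" if "i < k" for i
    using not_less_Least[of i "\<lambda>k. (k \<in> a) \<noteq> (k \<in> b)"] that unfolding k_def by simp
  then have eq: "a \<inter> {..<k} = b \<inter> {..<k}" by auto
  obtain i where "i < n" "(i \<in> a) \<noteq> (i \<in> b)" using ex by blast
  then have "k < n" using less[of i] by (meson not_less order_le_less_trans)
  have "sep * \<rho> ^ n \<le> sep * \<rho> ^ k"
    using \<open>k < n\<close> rho sep_pos by (intro mult_left_mono power_decreasing) auto
  also have "\<dots> \<le> \<bar>cantor_value \<rho> a - cantor_value \<rho> b\<bar>"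
    using cantor_value_gap[OF eq] cantor_value_gap[OF eq[symmetric]] k by fastforce
  finally show ?thesis unfolding dist_cantor_point .
qed

lemma inj_cantor_point: "inj (cantor_point \<rho> :: nat set \<Rightarrow> 'a::euclidean_space)"
proof (rule injI, rule ccontr)
  fix a b assume eq: "cantor_point \<rho> a = (cantor_point \<rho> b :: 'a)" and "a \<noteq> b"
  then obtain k where "(k \<in> a) \<noteq> (k \<in> b)" by blast
  then have "a \<inter> {..<Suc k} \<noteq> b \<inter> {..<Suc k}" by blast
  from dist_cantor_point_ge[OF this, where 'a='a] eq have "sep * \<rho> ^ Suc k \<le> 0" by simp
  then show False
    using mult_pos_pos[OF sep_pos, of "\<rho> ^ Suc k"] rho by simp
qed

lemma rho_power_small:
  assumes "0 < (e::real)" shows "\<exists>n. K * \<rho> ^ n < e"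
proof -
  have "(\<lambda>n. K * \<rho> ^ n) \<longlonglongrightarrow> K * 0"
    by (rule tendsto_mult_left, rule LIMSEQ_power_zero) (use rho in simp)
  then have "\<forall>\<^sub>F n in sequentially. K * \<rho> ^ n < e"
    using order_tendstoD(2)[of _ "K * 0" sequentially e] assms by simp
  then show ?thesis by (auto simp: eventually_sequentially)
qed

text \<open>The image is closed because points with converging images have eventually constant prefixes, by
\<open>dist_cantor_point_ge\<close>; the common prefixes define the code of the limit.\<close>

lemma compact_cantor_image:
  assumes "prefix_closed A"
  shows "compact (cantor_point \<rho> ` A :: 'a::euclidean_space set)"
  unfolding compact_eq_bounded_closed
proof
  show "bounded (cantor_point \<rho> ` A :: 'a set)"
    unfolding bounded_def
    by (rule exI[of _ "cantor_point \<rho> {}"], rule exI[of _ spread])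
      (use dist_cantor_point_le[of "{}" 0] in auto)
  show "closed (cantor_point \<rho> ` A :: 'a set)"
    unfolding closure_subset_eq[symmetric]
  proof
    fix x assume "x \<in> closure (cantor_point \<rho> ` A :: 'a set)"
    then have near: "\<exists>a\<in>A. dist x (cantor_point \<rho> a) < e" if "0 < e" for e
      using that by (auto simp: closure_approachable dist_commute)
    have "0 < sep * \<rho> ^ n / 2" for n
      using sep_pos rho by simp
    then have "\<forall>n. \<exists>a\<in>A. dist x (cantor_point \<rho> a) < sep * \<rho> ^ n / 2"
      using near by blast
    then obtain f where f: "\<And>n. f n \<in> A" "\<And>n. dist x (cantor_point \<rho> (f n)) < sep * \<rho> ^ n / 2"
      by metis
    have agree: "f m \<inter> {..<n} = f n \<inter> {..<n}" if "n \<le> m" for m n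
    proof (rule ccontr)
      assume "f m \<inter> {..<n} \<noteq> f n \<inter> {..<n}"
      from dist_cantor_point_ge[OF this, where 'a='a]
      have "sep * \<rho> ^ n \<le> dist x (cantor_point \<rho> (f m)) + dist x (cantor_point \<rho> (f n))"
        using dist_triangle[of "cantor_point \<rho> (f m)" "cantor_point \<rho> (f n)" x] by (simp add: dist_commute)
      moreover have "sep * \<rho> ^ m \<le> sep * \<rho> ^ n"
        using that rho sep_pos by (intro mult_left_mono power_decreasing) auto
      ultimately show False using f(2)[of m] f(2)[of n] by linarith
    qed
    \<comment> \<open>By \<open>agree\<close>, position \<open>k\<close> is the same in all \<open>f n\<close> with \<open>n > k\<close>.\<close>
    define b where "b = {k. k \<in> f (Suc k)}"
    have b: "f n \<inter> {..<n} = b \<inter> {..<n}" for n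
    proof -
      have "k \<in> f n \<longleftrightarrow> k \<in> f (Suc k)" if "k < n" for k
        using agree[of "Suc k" n] that by (auto simp: set_eq_iff)
      then show ?thesis unfolding b_def by auto
    qed
    have "\<exists>a\<in>A. a \<inter> {..<n} = b \<inter> {..<n}" for n
      using b[of n] f(1)[of n] by (rule bexI)
    then have "b \<in> A"
      by (rule assms[unfolded prefix_closed_def, rule_format])
    have "x = cantor_point \<rho> b"
    proof (rule ccontr)
      assume "x \<noteq> cantor_point \<rho> b"
      then obtain n where n: "(sep / 2 + spread) * \<rho> ^ n < dist x (cantor_point \<rho> b)"
        using rho_power_small[of "dist x (cantor_point \<rho> b)"] by auto
      have "dist x (cantor_point \<rho> b) \<le> dist x (cantor_point \<rho> (f n)) + dist (cantor_point \<rho> (f n) :: 'a) (cantor_point \<rho> b)"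
        by (rule dist_triangle)
      also have "\<dots> \<le> sep * \<rho> ^ n / 2 + spread * \<rho> ^ n"
        using f(2)[of n] dist_cantor_point_le[OF b, of n, where 'a='a] by linarith
      finally show False using n by (simp add: algebra_simps)
    qed
    with \<open>b \<in> A\<close> show "x \<in> cantor_point \<rho> ` A" by blast
  qed
qed

text \<open>Every small radius lies between two consecutive scales, so estimates at the scales \<open>K * \<rho>^n\<close> carry
over to all radii at the cost of a constant factor.\<close>

lemma scale_between:
  assumes "0 < r" "r < K"
  obtains n where "K * \<rho> ^ Suc n \<le> r" "r < K * \<rho> ^ n"
proof -
  define n where "n = (LEAST n. K * \<rho> ^ n \<le> r)"
  have ex: "\<exists>n. K * \<rho> ^ n \<le> r" using rho_power_small[OF assms(1), of K] by (auto intro: less_imp_le)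
  then have n: "K * \<rho> ^ n \<le> r" unfolding n_def by (rule LeastI_ex)
  with assms have "n \<noteq> 0" by (cases n) auto
  then obtain m where m: "n = Suc m" by (cases n) auto
  then have "\<not> K * \<rho> ^ m \<le> r" using not_less_Least[of m "\<lambda>n. K * \<rho> ^ n \<le> r"] unfolding n_def by simp
  then show ?thesis using that[of m] n m by simp
qed

end

section \<open>Fair coin measures\<close>

definition coin_space :: "(nat \<Rightarrow> bool) measure" where
  "coin_space = Pi\<^sub>M UNIV (\<lambda>_. measure_pmf (bernoulli_pmf (1/2)))"

lemma prob_space_coin_space: "prob_space coin_space"
  unfolding coin_space_def by (intro prob_space_PiM measure_pmf.prob_space_axioms)

lemma space_coin_space [simp]: "space coin_space = UNIV"
  by (simp add: coin_space_def space_PiM)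

lemma measurable_coin_component [measurable]: "Measurable.pred coin_space (\<lambda>f. f k)"
proof -
  have "(\<lambda>f. f k) \<in> coin_space \<rightarrow>\<^sub>M measure_pmf (bernoulli_pmf (1/2))"
    unfolding coin_space_def by measurable
  then show ?thesis by (simp add: measurable_def)
qed

lemma measure_coin_cylinder:
  assumes "finite J"
  shows "measure coin_space {f. \<forall>k\<in>J. f k \<longleftrightarrow> k \<in> a} = (1/2) ^ card J"
proof -
  interpret product_prob_space "\<lambda>_. measure_pmf (bernoulli_pmf (1/2))" "UNIV :: nat set"
    by unfold_locales
  have "measure coin_space {f. \<forall>k\<in>J. f k \<longleftrightarrow> k \<in> a}
      = measure (Pi\<^sub>M UNIV (\<lambda>_. measure_pmf (bernoulli_pmf (1/2))))
          (prod_emb UNIV (\<lambda>_. measure_pmf (bernoulli_pmf (1/2))) J (Pi\<^sub>E J (\<lambda>k. {k \<in> a})))"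
    unfolding coin_space_def by (rule arg_cong2[where f=measure]) (auto simp: prod_emb_def PiE_def Pi_def)
  also have "\<dots> = (\<Prod>k\<in>J. measure_pmf.prob (bernoulli_pmf (1/2)) {k \<in> a})"
    by (rule measure_PiM_emb) (use assms in auto)
  also have "\<dots> = (\<Prod>k\<in>J. 1/2)"
    by (intro prod.cong) (auto simp: measure_pmf_single)
  finally show ?thesis by simp
qed

text \<open>Fair coins are tossed at all positions and the outcomes outside \<open>S\<close> are then discarded, so every
single outcome, and not only almost every one, yields a sequence inside \<open>S\<close>.\<close>

definition coin_measure :: "real \<Rightarrow> nat set \<Rightarrow> 'a::euclidean_space measure" where
  "coin_measure \<rho> S = distr coin_space borel (\<lambda>f. cantor_point \<rho> ({k. f k} \<inter> S))"

context cantor_ratio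
begin

lemma measurable_coin_point [measurable]:
  "(\<lambda>f. cantor_point \<rho> ({k. f k} \<inter> S) :: 'a::euclidean_space) \<in> borel_measurable coin_space"
proof -
  have "(\<lambda>f. if k \<in> {k. f k} \<inter> S then \<rho> ^ k else 0) \<in> borel_measurable coin_space" for k
    by simp
  then have "(\<lambda>f. cantor_value \<rho> ({k. f k} \<inter> S)) \<in> borel_measurable coin_space"
    unfolding cantor_value_def by (rule borel_measurable_suminf)
  then show ?thesis unfolding cantor_point_def by measurable
qed

lemma prob_space_coin_measure: "prob_space (coin_measure \<rho> S :: 'a::euclidean_space measure)"
  unfolding coin_measure_def by (intro prob_space.prob_space_distr prob_space_coin_space measurable_coin_point)

lemma sets_coin_measure: "sets (coin_measure \<rho> S :: 'a::euclidean_space measure) = sets borel"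
  by (simp add: coin_measure_def)

lemma measure_coin_measure:
  assumes "B \<in> sets borel"
  shows "measure (coin_measure \<rho> S :: 'a::euclidean_space measure) B =
    measure coin_space {f. cantor_point \<rho> ({k. f k} \<inter> S) \<in> B}"
  unfolding coin_measure_def
  by (subst measure_distr[OF measurable_coin_point assms]) (auto simp: vimage_def)

text \<open>A ball of radius below \<open>sep * \<rho>^n\<close> determines the first \<open>n\<close> positions of the sequences coded
in it, hence the tosses at the positions of \<open>S\<close> below \<open>n\<close>.\<close>

lemma coin_measure_cball_le:
  assumes "r < sep * \<rho> ^ n"
  shows "measure (coin_measure \<rho> S) (cball (cantor_point \<rho> a :: 'a::euclidean_space) r) \<le> (1/2) ^ card (S \<inter> {..<n})"
proof -
  interpret C: prob_space coin_space by (rule prob_space_coin_space)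
  have "measure coin_space {f. cantor_point \<rho> ({k. f k} \<inter> S) \<in> cball (cantor_point \<rho> a :: 'a) r}
      \<le> measure coin_space {f. \<forall>k\<in>S \<inter> {..<n}. f k \<longleftrightarrow> k \<in> a}"
  proof (rule C.finite_measure_mono)
    show "{f. cantor_point \<rho> ({k. f k} \<inter> S) \<in> cball (cantor_point \<rho> a :: 'a) r} \<subseteq> {f. \<forall>k\<in>S \<inter> {..<n}. f k \<longleftrightarrow> k \<in> a}"
    proof
      fix f assume "f \<in> {f. cantor_point \<rho> ({k. f k} \<inter> S) \<in> cball (cantor_point \<rho> a :: 'a) r}"
      then have "dist (cantor_point \<rho> a :: 'a) (cantor_point \<rho> ({k. f k} \<inter> S)) < sep * \<rho> ^ n"
        using assms by auto
      then have "a \<inter> {..<n} = ({k. f k} \<inter> S) \<inter> {..<n}"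
        using dist_cantor_point_ge[of a n "{k. f k} \<inter> S", where 'a='a] by fastforce
      then show "f \<in> {f. \<forall>k\<in>S \<inter> {..<n}. f k \<longleftrightarrow> k \<in> a}" by auto
    qed
    have "{f \<in> space coin_space. \<forall>k\<in>S \<inter> {..<n}. f k \<longleftrightarrow> k \<in> a} \<in> sets coin_space" by measurable
    then show "{f. \<forall>k\<in>S \<inter> {..<n}. f k \<longleftrightarrow> k \<in> a} \<in> sets coin_space" by simp
  qed
  then show ?thesis by (simp add: measure_coin_measure measure_coin_cylinder)
qed

lemma coin_measure_cball_ge:
  assumes "spread * \<rho> ^ n \<le> r"
  shows "(1/2) ^ n \<le> measure (coin_measure \<rho> UNIV) (cball (cantor_point \<rho> a :: 'a::euclidean_space) r)"
proof -
  interpret C: prob_space coin_space by (rule prob_space_coin_space)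
  have "measure coin_space {f. \<forall>k\<in>{..<n}. f k \<longleftrightarrow> k \<in> a}
      \<le> measure coin_space {f. cantor_point \<rho> ({k. f k} \<inter> UNIV) \<in> cball (cantor_point \<rho> a :: 'a) r}"
  proof (rule C.finite_measure_mono)
    show "{f. \<forall>k\<in>{..<n}. f k \<longleftrightarrow> k \<in> a} \<subseteq> {f. cantor_point \<rho> ({k. f k} \<inter> UNIV) \<in> cball (cantor_point \<rho> a :: 'a) r}"
    proof
      fix f assume "f \<in> {f. \<forall>k\<in>{..<n}. f k \<longleftrightarrow> k \<in> a}"
      then have "a \<inter> {..<n} = ({k. f k} \<inter> UNIV) \<inter> {..<n}" by auto
      from dist_cantor_point_le[OF this, where 'a='a] assms
      show "f \<in> {f. cantor_point \<rho> ({k. f k} \<inter> UNIV) \<in> cball (cantor_point \<rho> a :: 'a) r}" by simp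
    qed
    have "(\<lambda>f. cantor_point \<rho> ({k. f k} \<inter> UNIV)) -` cball (cantor_point \<rho> a :: 'a) r \<inter> space coin_space \<in> sets coin_space"
      by (rule measurable_sets[OF measurable_coin_point]) auto
    then show "{f. cantor_point \<rho> ({k. f k} \<inter> UNIV) \<in> cball (cantor_point \<rho> a :: 'a) r} \<in> sets coin_space"
      by (simp add: vimage_def)
  qed
  then show ?thesis using measure_coin_cylinder[of "{..<n}" a] by (simp add: measure_coin_measure)
qed

end

section \<open>Positions of given density\<close>

text \<open>The positions at which the floor of \<open>k \<theta>\<close> jumps, a set of density \<open>\<theta>\<close> with bounded
discrepancy.\<close>

definition spaced_positions :: "real \<Rightarrow> nat set" where
  "spaced_positions \<theta> = {k. \<lfloor>real k * \<theta>\<rfloor> < \<lfloor>real (Suc k) * \<theta>\<rfloor>}"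

lemma card_spaced_positions:
  assumes "0 \<le> \<theta>" "\<theta> \<le> 1"
  shows "int (card (spaced_positions \<theta> \<inter> {..<n})) = \<lfloor>real n * \<theta>\<rfloor>"
proof (induction n)
  case 0
  then show ?case by simp
next
  case (Suc n)
  have step: "real (Suc n) * \<theta> = real n * \<theta> + \<theta>" by (simp add: algebra_simps)
  have "\<lfloor>real n * \<theta>\<rfloor> \<le> \<lfloor>real (Suc n) * \<theta>\<rfloor>" "\<lfloor>real (Suc n) * \<theta>\<rfloor> \<le> \<lfloor>real n * \<theta>\<rfloor> + 1"
    unfolding step using assms by linarith+
  then show ?case
    using Suc.IH by (auto simp: lessThan_Suc spaced_positions_def Int_insert_right)
qed

lemma card_spaced_positions_le:
  assumes "0 \<le> \<theta>" "\<theta> \<le> 1"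
  shows "real (card (spaced_positions \<theta> \<inter> {..<n})) \<le> real n * \<theta>"
  using card_spaced_positions[OF assms, of n] by linarith

lemma card_spaced_positions_ge:
  assumes "0 \<le> \<theta>" "\<theta> \<le> 1"
  shows "real n * \<theta> - 1 \<le> real (card (spaced_positions \<theta> \<inter> {..<n}))"
  using card_spaced_positions[OF assms, of n] by linarith

section \<open>Marked sequences\<close>

text \<open>A number for the prefix of length \<open>l\<close>: the additional top bit \<open>l\<close> records the length.\<close>

definition prefix_code :: "nat \<Rightarrow> nat set \<Rightarrow> nat" where
  "prefix_code l a = set_encode (insert l (a \<inter> {..<l}))"

lemma prefix_code_gt: "l < prefix_code l a"
proof -
  have "l < 2 ^ l" by (rule less_exp)
  then show ?thesis unfolding prefix_code_def by (subst set_encode_insert) (auto intro: trans_less_add1)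
qed

lemma prefix_code_less:
  assumes "l < n" shows "prefix_code l a < 2 ^ n"
proof -
  have "prefix_code l a \<le> sum ((^) 2) {0..<n}"
    unfolding prefix_code_def set_encode_def using assms by (intro sum_mono2) auto
  also have "\<dots> < 2 ^ n" by (simp add: sum_power2)
  finally show ?thesis .
qed

lemma prefix_code_eqD:
  assumes "prefix_code l a = prefix_code l' b"
  shows "l = l' \<and> a \<inter> {..<l} = b \<inter> {..<l}"
proof -
  have eq: "insert l (a \<inter> {..<l}) = insert l' (b \<inter> {..<l'})"
    using assms unfolding prefix_code_def by (subst (asm) set_encode_eq) auto
  have "l \<in> insert l' (b \<inter> {..<l'})" "l' \<in> insert l (a \<inter> {..<l})"
    using eq by blast+
  then have "l = l'" by auto
  with eq show ?thesis by auto
qed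

text \<open>For each \<open>m > 0\<close> this is the set of all sequences with one particular prefix, and every sequence has
a marking prefix of every length.\<close>

definition marked :: "nat \<Rightarrow> nat set set" where
  "marked m = {a. \<exists>l. prefix_code l a = m}"

text \<open>The code of a prefix exceeds its length, so membership in \<open>marked m\<close> is decided below \<open>m\<close>.\<close>

lemma marked_prefix:
  assumes "a \<in> marked m" "a \<inter> {..<m} = b \<inter> {..<m}"
  shows "b \<in> marked m"
proof -
  obtain l where l: "prefix_code l a = m" using assms(1) unfolding marked_def by blast
  then have "l < m" using prefix_code_gt by blast
  then have "a \<inter> {..<l} = b \<inter> {..<l}" by (intro prefix_eq_mono[OF assms(2)]) simp
  then have "prefix_code l b = m" using l unfolding prefix_code_def by simp
  then show ?thesis unfolding marked_def by blast
qed

lemma marked_infinitely_often: "\<exists>m\<ge>n. a \<in> marked m"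
  unfolding marked_def using prefix_code_gt[of n a] by (blast intro: less_imp_le)

text \<open>Only prefixes of length at least \<open>n\<close> have a code of size \<open>2^n\<close> or more.\<close>

lemma marked_agree:
  assumes "2 ^ n \<le> m" "a \<in> marked m" "b \<in> marked m"
  shows "a \<inter> {..<n} = b \<inter> {..<n}"
proof -
  obtain l l' where l: "prefix_code l a = m" "prefix_code l' b = m"
    using assms unfolding marked_def by blast
  then have "a \<inter> {..<l} = b \<inter> {..<l}" using prefix_code_eqD by metis
  moreover have "n \<le> l" using prefix_code_less[of l n a] l assms(1) by (meson leD leI)
  ultimately show ?thesis by (rule prefix_eq_mono)
qed

text \<open>Factorials make each window negligible compared with the next one.\<close>

definition window :: "nat \<Rightarrow> nat set" where
  "window m = {fact m..<fact (Suc m)}"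

definition code_set :: "nat set \<Rightarrow> nat set set" where
  "code_set S = {a. \<forall>k\<in>a. k \<in> S \<or> (\<exists>m. k \<in> window m \<and> a \<in> marked m)}"

lemma le_window: "k \<in> window m \<Longrightarrow> m \<le> k"
  unfolding window_def using fact_ge_self[of m] by (auto intro: order_trans)

text \<open>A position \<open>k\<close> in the window \<open>m\<close> satisfies \<open>m \<le> m! \<le> k\<close>, so a sequence is already known to be
marked by \<open>m\<close>, or not to be, when position \<open>k\<close> is reached. The constraint on a position therefore
involves earlier positions only.\<close>

lemma code_set_prefix:
  assumes a: "a \<in> code_set S" and eq: "a \<inter> {..<n} = b \<inter> {..<n}" and k: "k \<in> b" "k < n"
  shows "k \<in> S \<or> (\<exists>m. k \<in> window m \<and> b \<in> marked m)"
proof (cases "k \<in> S")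
  case False
  have "k \<in> a" using eq k by auto
  with a False obtain m where m: "k \<in> window m" "a \<in> marked m" unfolding code_set_def by blast
  have "m < n" using le_window[OF m(1)] k by simp
  then have "a \<inter> {..<m} = b \<inter> {..<m}" by (intro prefix_eq_mono[OF eq]) simp
  with m show ?thesis using marked_prefix by blast
qed simp

lemma prefix_closed_code_set: "prefix_closed (code_set S)"
  unfolding prefix_closed_def
proof (intro allI impI)
  fix b assume b: "\<forall>n. \<exists>a\<in>code_set S. a \<inter> {..<n} = b \<inter> {..<n}"
  have "k \<in> S \<or> (\<exists>m. k \<in> window m \<and> b \<in> marked m)" if "k \<in> b" for k
  proof -
    obtain a where "a \<in> code_set S" "a \<inter> {..<Suc k} = b \<inter> {..<Suc k}" using b by blast
    then show ?thesis using code_set_prefix that by blast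
  qed
  then show "b \<in> code_set S" unfolding code_set_def by blast
qed

section \<open>Measures on coded sets\<close>

context cantor_ratio
begin

lemma borel_cantor_image:
  assumes "prefix_closed A"
  shows "cantor_point \<rho> ` A \<in> sets (borel :: 'a::euclidean_space measure)"
  using compact_cantor_image[OF assms, where 'a='a] by (intro borel_closed compact_imp_closed)

text \<open>The form of \<open>corr_integral_ge_pieces\<close> used below: the pieces are given by the prefixes in \<open>W\<close>.\<close>

lemma corr_integral_ge_words:
  fixes \<mu> :: "'a::euclidean_space measure"
  assumes "prob_space \<mu>" "sets \<mu> = sets borel" "prefix_closed A" "finite W"
  shows "measure \<mu> (cantor_point \<rho> ` {a \<in> A. a \<inter> {..<n} \<in> W})^2 \<le> card W * corr_integral \<mu> (spread * \<rho> ^ n)"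
proof -
  define Q :: "nat set \<Rightarrow> 'a set" where "Q w = cantor_point \<rho> ` (A \<inter> {a. a \<inter> {..<n} = w})" for w
  have un: "cantor_point \<rho> ` {a \<in> A. a \<inter> {..<n} \<in> W} = (\<Union>w\<in>W. Q w)"
    unfolding Q_def by blast
  show ?thesis unfolding un
  proof (rule corr_integral_ge_pieces[OF assms(1,2,4)])
    have "Q v \<inter> Q w = {}" if "v \<noteq> w" for v w
    proof -
      have "(A \<inter> {a. a \<inter> {..<n} = v}) \<inter> (A \<inter> {a. a \<inter> {..<n} = w}) = {}" using that by blast
      then show ?thesis unfolding Q_def by (subst image_Int[OF inj_cantor_point, symmetric]) simp
    qed
    then show "disjoint_family_on Q W" unfolding disjoint_family_on_def by blast
    show "Q w \<in> sets borel" for w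
      unfolding Q_def by (intro borel_cantor_image prefix_closed_Int[where n=n] assms(3)) simp
    show "dist x y \<le> spread * \<rho> ^ n" if xy: "x \<in> Q w" "y \<in> Q w" for w x y
    proof -
      obtain a b where "x = cantor_point \<rho> a" "y = cantor_point \<rho> b" "a \<inter> {..<n} = w" "b \<inter> {..<n} = w"
        using xy unfolding Q_def by blast
      then show ?thesis using dist_cantor_point_le[of a n b, where 'a='a] by simp
    qed
  qed
qed

lemma prob_measure_on_image:
  fixes \<mu> :: "'a::euclidean_space measure"
  assumes "prefix_closed A" "\<mu> \<in> prob_measures_on (cantor_point \<rho> ` A)"
  shows "prob_space \<mu>" "sets \<mu> = sets borel" "measure \<mu> (cantor_point \<rho> ` A) = 1"
proof -
  show p: "prob_space \<mu>" and s: "sets \<mu> = sets borel" using assms(2) by (auto simp: prob_measures_on_def)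
  interpret prob_space \<mu> by fact
  have sp: "space \<mu> = UNIV" using sets_eq_imp_space_eq[OF s] by simp
  have meas: "cantor_point \<rho> ` A \<in> sets \<mu>" using borel_cantor_image[OF assms(1)] s by simp
  have "measure \<mu> (UNIV - cantor_point \<rho> ` A) = 0"
    using assms(2) by (simp add: prob_measures_on_def measure_def)
  then show "measure \<mu> (cantor_point \<rho> ` A) = 1"
    using prob_compl[OF meas] sp by simp
qed

text \<open>Positivity matters because \<open>ln 0 = 0\<close> would spoil lower bounds for the correlation dimension.\<close>

lemma corr_integral_pos:
  fixes \<mu> :: "'a::euclidean_space measure"
  assumes "prefix_closed A" "\<mu> \<in> prob_measures_on (cantor_point \<rho> ` A)" "0 < r"
  shows "0 < corr_integral \<mu> r"
proof -
  note p = prob_measure_on_image[OF assms(1,2)]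
  obtain n where n: "spread * \<rho> ^ n < r" using rho_power_small[OF assms(3)] by blast
  have all: "{a \<in> A. a \<inter> {..<n} \<in> Pow {..<n}} = A" by auto
  have "1 \<le> card (Pow {..<n}) * corr_integral \<mu> (spread * \<rho> ^ n)"
    using corr_integral_ge_words[OF p(1,2) assms(1), of "Pow {..<n}" n] unfolding all p(3) by simp
  then have "0 < corr_integral \<mu> (spread * \<rho> ^ n)"
    by (smt (verit) mult_nonneg_nonpos of_nat_0_le_iff)
  also have "\<dots> \<le> corr_integral \<mu> r"
    using n by (intro corr_integral_mono p) simp
  finally show ?thesis .
qed

end

lemma half_powr: "(1/2) powr x = 2 powr (- x :: real)"
proof -
  have "(1/2 :: real) = 2 powr (-1)" by (simp only: powr_neg_one)
  then have "(1/2) powr x = (2 powr (-1)) powr x" by (rule arg_cong)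
  also have "\<dots> = 2 powr (- x)" by (simp only: powr_powr mult_minus1)
  finally show ?thesis .
qed

lemma two_powr_minus_nat: "2 powr (- real n) = (1/2) ^ n"
  by (subst half_powr[symmetric], rule powr_realpow) simp

text \<open>The condition on \<open>s\<close> says that doubling the number of prefixes corresponds to one more scale:
\<open>s\<close> is the similarity dimension of the Cantor set of all sequences.\<close>

locale cantor_dim = cantor_ratio +
  fixes s :: real
  assumes s_pos: "0 < s" and rho_powr_s: "\<rho> powr s = 1/2"
begin

lemma rho_power_powr: "(\<rho> ^ n) powr (s * x) = 2 powr (- (real n * x))"
proof -
  have "(\<rho> ^ n) powr (s * x) = (\<rho> powr s) powr (real n * x)"
    using rho by (simp add: powr_powr flip: powr_realpow) (simp add: mult_ac)
  also have "\<dots> = 2 powr (- (real n * x))"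
    unfolding rho_powr_s by (rule half_powr)
  finally show ?thesis .
qed

lemma upper_corr_dim_measure_le_of_scales:
  fixes \<mu> :: "'a::euclidean_space measure"
  assumes "prob_space \<mu>" "sets \<mu> = sets borel" "0 < K" "0 \<le> v"
    and bd: "\<And>n. N \<le> n \<Longrightarrow> K * (\<rho> ^ n) powr v \<le> corr_integral \<mu> (spread * \<rho> ^ n)"
  shows "upper_corr_dim_measure \<mu> \<le> ereal v"
proof (rule upper_corr_dim_measure_le)
  show "0 < K * (\<rho> / spread) powr v" using assms(3) rho spread_pos by simp
  have "0 < spread * \<rho> ^ N" using rho spread_pos by simp
  then have "\<forall>\<^sub>F r in at_right 0. r \<in> {0<..<spread * \<rho> ^ N}" by (rule eventually_at_right_real)
  then show "\<forall>\<^sub>F r in at_right 0. K * (\<rho> / spread) powr v * r powr v \<le> corr_integral \<mu> r"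
  proof eventually_elim
    case (elim r)
    have "spread * \<rho> ^ N \<le> spread"
      using rho spread_pos by (intro mult_left_le power_le_one) auto
    then have "r < spread" using elim by simp
    then obtain n where n: "spread * \<rho> ^ Suc n \<le> r" "r < spread * \<rho> ^ n"
      using scale_between[of r spread] elim by auto
    have "spread * \<rho> ^ Suc n < spread * \<rho> ^ N" using n elim by simp
    then have "\<rho> ^ Suc n < \<rho> ^ N" using spread_pos by (simp only: mult_less_cancel_left_pos)
    then have "N \<le> Suc n"
      using rho power_decreasing[of "Suc n" N \<rho>] by (cases "N \<le> Suc n") auto
    have "K * (\<rho> / spread) powr v * r powr v = K * (\<rho> / spread * r) powr v"
      using elim rho spread_pos powr_mult[of "\<rho> / spread" r v] by (simp only: mult.assoc)
    also have "\<dots> \<le> K * (\<rho> ^ Suc n) powr v"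
      using n elim rho spread_pos assms(3,4)
      by (intro mult_left_mono powr_mono2) (auto simp: field_simps)
    also have "\<dots> \<le> corr_integral \<mu> (spread * \<rho> ^ Suc n)"
      by (rule bd) fact
    also have "\<dots> \<le> corr_integral \<mu> r"
      by (intro corr_integral_mono assms n)
    finally show ?case .
  qed
qed

section \<open>Packing dimension of the coded set\<close>

text \<open>The fair coin measure on all positions gives mass at least a constant times \<open>r powr s\<close> to each ball
around a coded point.\<close>

lemma packing_dim_cantor_image_le:
  "packing_dim (cantor_point \<rho> ` A :: 'a::euclidean_space set) \<le> ereal s"
proof -
  interpret prob_space "coin_measure \<rho> UNIV :: 'a measure" by (rule prob_space_coin_measure)
  have mass: "(1 / (2 * spread powr s)) * r powr s \<le> measure (coin_measure \<rho> UNIV) (cball x r)"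
    if x: "x \<in> cantor_point \<rho> ` A" and r: "0 < r" "r \<le> 1" for x :: 'a and r
  proof -
    have "1 < spread" using rho by (simp add: spread_def)
    then obtain n where n: "spread * \<rho> ^ Suc n \<le> r" "r < spread * \<rho> ^ n"
      using scale_between[of r spread] r by auto
    obtain a where a: "x = cantor_point \<rho> a" using x by blast
    have "r powr s \<le> (spread * \<rho> ^ n) powr s"
      using n r s_pos by (intro powr_mono2) auto
    also have "\<dots> = spread powr s * (1/2) ^ n"
      using rho_power_powr[of n 1] rho spread_pos by (simp add: powr_mult two_powr_minus_nat)
    finally have "(1 / (2 * spread powr s)) * r powr s \<le> (1/2) ^ Suc n"
      using spread_pos by (simp add: field_simps)
    also have "\<dots> \<le> measure (coin_measure \<rho> UNIV) (cball x r)"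
      unfolding a by (rule coin_measure_cball_ge[OF n(1)])
    finally show ?thesis .
  qed
  have zero: "packing_measure u (cantor_point \<rho> ` A :: 'a set) = 0" if "s < u" for u
    by (rule packing_measure_eq_0[OF finite_measure_axioms sets_coin_measure _ _ that mass])
      (use s_pos spread_pos in auto)
  show ?thesis
  proof (rule ereal_le_epsilon2)
    fix e :: real assume "0 < e"
    then show "packing_dim (cantor_point \<rho> ` A :: 'a set) \<le> ereal s + ereal e"
      unfolding packing_dim_def using s_pos zero[of "s + e"] by (intro Inf_lower) auto
  qed
qed

text \<open>The separated points come from the window \<open>m\<close> of an index \<open>m\<close> marking \<open>a\<close>: below \<open>j = m!\<close> they
follow \<open>a\<close>, in the window they are arbitrary, and from \<open>k = (m+1)!\<close> on they vanish. Moving them into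
the dense set \<open>F\<close> costs a fraction of their separation. The weight of the packing is about
\<open>2 powr (k - j - k u/s)\<close>, which is unbounded as \<open>j = k/(m+1)\<close> and \<open>u < s\<close>.\<close>

lemma packing_premeasure_dense_infinite:
  fixes F :: "'a::euclidean_space set"
  assumes a: "a \<in> code_set S" and e: "0 < e"
    and dense: "cantor_point \<rho> ` code_set S \<inter> ball (cantor_point \<rho> a) e \<subseteq> closure F"
    and u: "0 \<le> u" "u < s"
  shows "packing_premeasure u F = \<infinity>"
proof -
  have "ennreal N \<le> packing_pre_delta u \<delta> F" if "0 < \<delta>" for \<delta> N :: real
  proof -
    \<comment> \<open>\<open>n1\<close> keeps the points in the ball, \<open>n2\<close> keeps the radius below \<open>\<delta>\<close>, \<open>n3\<close> makes the weight reach \<open>N\<close>, and \<open>n4\<close> makes the window long enough for \<open>u < s\<close>.\<close>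
    obtain n1 where n1: "spread * \<rho> ^ n1 < e" using rho_power_small[OF e] by blast
    obtain n2 where n2: "sep / 8 * \<rho> ^ n2 < \<delta>" using rho_power_small[OF \<open>0 < \<delta>\<close>] by blast
    define c where "c = (sep / 4) powr u"
    have "0 < c" using sep_pos by (simp add: c_def)
    define n3 where "n3 = nat \<lceil>N / c\<rceil>"
    define n4 where "n4 = nat \<lceil>2 / (1 - u / s)\<rceil>"
    obtain m where m: "n1 + n2 + n3 + n4 \<le> m" "a \<in> marked m" using marked_infinitely_often by blast
    define j k where "j = (fact m :: nat)" and "k = (fact (Suc m) :: nat)"
    have k: "k = (m + 1) * j" unfolding j_def k_def by simp
    have "m \<le> j" unfolding j_def by (rule fact_ge_self)
    have "j \<le> k" unfolding k by simp
    define b where "b w = a \<inter> {..<j} \<union> w" for w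
    have b_prefix: "b w \<inter> {..<j} = a \<inter> {..<j}" if "w \<in> Pow {j..<k}" for w
      using that unfolding b_def by auto
    have b_code: "b w \<in> code_set S" if w: "w \<in> Pow {j..<k}" for w
    proof -
      have "b w \<in> marked m"
        by (rule marked_prefix[OF m(2) prefix_eq_mono[OF b_prefix[OF w, symmetric] \<open>m \<le> j\<close>]])
      moreover have "w \<subseteq> window m" using w unfolding window_def j_def k_def by simp
      ultimately have "i \<in> S \<or> (\<exists>m. i \<in> window m \<and> b w \<in> marked m)" if "i \<in> b w" for i
        using code_set_prefix[OF a b_prefix[OF w, symmetric] that] that unfolding b_def by blast
      then show ?thesis unfolding code_set_def by blast
    qed
    \<comment> \<open>The points coded by \<open>b w\<close> lie in the ball, so \<open>F\<close> comes arbitrarily close to them.\<close>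
    have "\<exists>y\<in>F. dist y (cantor_point \<rho> (b w)) < sep * \<rho> ^ k / 4" if w: "w \<in> Pow {j..<k}" for w
    proof -
      have "dist (cantor_point \<rho> a :: 'a) (cantor_point \<rho> (b w)) \<le> spread * \<rho> ^ j"
        using b_prefix[OF w] by (intro dist_cantor_point_le) simp
      also have "\<dots> \<le> spread * \<rho> ^ n1"
        using rho spread_pos m(1) \<open>m \<le> j\<close> by (intro mult_left_mono power_decreasing) auto
      also have "\<dots> < e" by fact
      finally have "cantor_point \<rho> (b w) \<in> closure F"
        using dense b_code[OF w] by auto
      moreover have "0 < sep * \<rho> ^ k / 4" using sep_pos rho by simp
      ultimately show ?thesis unfolding closure_approachable by blast
    qed
    then obtain y where y: "\<And>w. w \<in> Pow {j..<k} \<Longrightarrow> y w \<in> F"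
      "\<And>w. w \<in> Pow {j..<k} \<Longrightarrow> dist (y w) (cantor_point \<rho> (b w)) < sep * \<rho> ^ k / 4"
      by metis
    have "ennreal (card (Pow {j..<k}) * (2 * (sep * \<rho> ^ k / 8)) powr u) \<le> packing_pre_delta u \<delta> F"
    proof (rule packing_pre_delta_ge)
      show "finite (Pow {j..<k})" by simp
      show "y ` Pow {j..<k} \<subseteq> F" using y(1) by blast
      show "0 < sep * \<rho> ^ k / 8" using sep_pos rho by simp
      have "sep / 8 * \<rho> ^ k \<le> sep / 8 * \<rho> ^ n2"
        using rho sep_pos m(1) \<open>m \<le> j\<close> \<open>j \<le> k\<close> by (intro mult_left_mono power_decreasing) auto
      with n2 show "sep * \<rho> ^ k / 8 \<le> \<delta>" by simp
      fix v w assume vw: "v \<in> Pow {j..<k}" "w \<in> Pow {j..<k}" "v \<noteq> w"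
      have "b v \<inter> {..<k} \<noteq> b w \<inter> {..<k}"
      proof
        assume eq: "b v \<inter> {..<k} = b w \<inter> {..<k}"
        have "b v \<inter> {..<k} - {..<j} = v" "b w \<inter> {..<k} - {..<j} = w"
          using vw unfolding b_def by auto
        with eq vw(3) show False by simp
      qed
      from dist_cantor_point_ge[OF this, where 'a='a]
      have "sep * \<rho> ^ k \<le> dist (y v) (cantor_point \<rho> (b v)) + dist (y v) (y w) + dist (y w) (cantor_point \<rho> (b w))"
        using dist_triangle[of "cantor_point \<rho> (b v)" "cantor_point \<rho> (b w)" "y v"]
          dist_triangle[of "y v" "cantor_point \<rho> (b w)" "y w"] by (simp add: dist_commute)
      moreover have "0 < sep * \<rho> ^ k" using sep_pos rho by simp
      ultimately show "2 * (sep * \<rho> ^ k / 8) < dist (y v) (y w)"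
        using y(2)[OF vw(1)] y(2)[OF vw(2)] by linarith
    qed
    moreover have "N \<le> card (Pow {j..<k}) * (2 * (sep * \<rho> ^ k / 8)) powr u"
    proof -
      define q where "q = 1 - u / s"
      have q: "0 < q" using u s_pos by (simp add: q_def)
      have "2 / q \<le> real m" using m(1) unfolding n4_def q_def[symmetric] by linarith
      then have "2 \<le> (real m + 1) * q" using q by (simp add: field_simps)
      then have "real j * 1 \<le> real j * ((real m + 1) * q - 1)"
        by (intro mult_left_mono) auto
      also have "\<dots> = real (k - j) - real k * (u / s)"
        using \<open>j \<le> k\<close> unfolding q_def by (simp add: k algebra_simps)
      finally have exponent: "real m \<le> real (k - j) - real k * (u / s)" using \<open>m \<le> j\<close> by simp
      have "N / c \<le> real m" using m(1) unfolding n3_def by linarith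
      also have "\<dots> \<le> 2 powr real m"
        using of_nat_less_two_power[of m, where 'a=real] by (simp add: powr_realpow)
      also have "\<dots> \<le> 2 powr (real (k - j) - real k * (u / s))"
        using exponent by (intro powr_mono) auto
      also have "\<dots> = 2 powr real (k - j) * 2 powr (- (real k * (u / s)))"
        by (simp add: powr_add[symmetric])
      also have "\<dots> = 2 ^ (k - j) * (\<rho> ^ k) powr (s * (u / s))"
        unfolding rho_power_powr by (simp add: powr_realpow)
      also have "s * (u / s) = u" using s_pos by simp
      finally have "N \<le> c * (2 ^ (k - j) * (\<rho> ^ k) powr u)"
        using \<open>0 < c\<close> by (simp add: field_simps)
      also have "\<dots> = card (Pow {j..<k}) * (2 * (sep * \<rho> ^ k / 8)) powr u"
        using sep_pos rho unfolding c_def by (simp add: card_Pow powr_mult[symmetric])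
      finally show ?thesis .
    qed
    ultimately show ?thesis by (meson ennreal_leI order_trans)
  qed
  then have "ennreal N \<le> packing_premeasure u F" for N :: real
    unfolding packing_premeasure_def by (intro INF_greatest) auto
  note large = this
  show ?thesis
  proof (cases "packing_premeasure u F")
    case (real x)
    then show ?thesis using large[of "x + 1"] by (simp add: ennreal_le_iff)
  qed simp
qed

lemma packing_dim_code_set:
  "packing_dim (cantor_point \<rho> ` code_set S :: 'a::euclidean_space set) = ereal s"
proof (rule antisym[OF packing_dim_cantor_image_le])
  let ?E = "cantor_point \<rho> ` code_set S :: 'a set"
  have "{} \<in> code_set S" by (simp add: code_set_def)
  then have ne: "?E \<noteq> {}" by blast
  have "s \<le> u" if u: "0 \<le> u" "packing_measure u ?E = 0" for u
  proof (rule ccontr)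
    assume "\<not> s \<le> u"
    obtain F x e where F: "packing_premeasure u F < \<infinity>" "x \<in> ?E" "0 < e" "?E \<inter> ball x e \<subseteq> closure F"
      using locally_dense_piece_of_packing_null[OF compact_cantor_image[OF prefix_closed_code_set] ne u(2)]
      by blast
    then obtain a where "x = cantor_point \<rho> a" "a \<in> code_set S" by blast
    then have "packing_premeasure u F = \<infinity>"
      using F \<open>\<not> s \<le> u\<close> u(1) by (intro packing_premeasure_dense_infinite) auto
    with F(1) show False by simp
  qed
  then show "ereal s \<le> packing_dim ?E"
    unfolding packing_dim_def by (intro Inf_greatest) auto
qed

section \<open>Correlation dimension of the coded set\<close>

lemma factorials_around:
  assumes "fact (Suc j0) \<le> n"
  obtains j where "j0 \<le> j" "fact (Suc j) \<le> n" "n < (fact (Suc (Suc j)) :: nat)"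
proof -
  define i where "i = (LEAST i. n < (fact (Suc (Suc (j0 + i))) :: nat))"
  have "n < fact (Suc (Suc (j0 + n)))"
    using fact_ge_self[of "Suc (Suc (j0 + n))"] by linarith
  then have i: "n < (fact (Suc (Suc (j0 + i))) :: nat)" unfolding i_def by (rule LeastI)
  have "fact (Suc (j0 + i)) \<le> n"
  proof (cases i)
    case 0
    then show ?thesis using assms by simp
  next
    case (Suc i')
    then have "\<not> n < (fact (Suc (Suc (j0 + i'))) :: nat)"
      using not_less_Least[of i' "\<lambda>i. n < (fact (Suc (Suc (j0 + i))) :: nat)"] unfolding i_def by simp
    then show ?thesis using Suc by simp
  qed
  with i show ?thesis using that[of "j0 + i"] by simp
qed

text \<open>Among the windows that begin below \<open>n\<close>, those of index \<open>j\<close> and \<open>j+1\<close> are not available to \<open>a\<close>, and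
all earlier ones end at or before \<open>j!\<close>.\<close>

lemma prefix_of_unmarked:
  assumes a: "a \<in> code_set S" "a \<notin> marked j" "a \<notin> marked (Suc j)" and n: "n < fact (Suc (Suc j))"
  shows "a \<inter> {..<n} \<subseteq> {..<fact j} \<union> (S \<inter> {..<n})"
proof
  fix k assume k: "k \<in> a \<inter> {..<n}"
  show "k \<in> {..<fact j} \<union> (S \<inter> {..<n})"
  proof (cases "k \<in> S")
    case False
    then obtain m where m: "k \<in> window m" "a \<in> marked m" using a k unfolding code_set_def by blast
    have "m < Suc (Suc j)"
    proof (rule ccontr)
      assume "\<not> m < Suc (Suc j)"
      then have "(fact (Suc (Suc j)) :: nat) \<le> fact m" by (intro fact_mono_nat) simp
      then show False using m(1) k n unfolding window_def by auto
    qed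
    moreover have "m \<noteq> j" "m \<noteq> Suc j" using m a by auto
    ultimately have "Suc m \<le> j" by simp
    then have "(fact (Suc m) :: nat) \<le> fact j" by (rule fact_mono_nat)
    then show ?thesis using m(1) unfolding window_def by auto
  qed (use k in simp)
qed

text \<open>Sets of small diameter have small mass unless the correlation integrals stay away from \<open>0\<close>. This
removes the marked sequences, which are the only ones with many prefixes at a given scale.\<close>

lemma upper_corr_dim_measure_code_set_le:
  fixes \<mu> :: "'a::euclidean_space measure"
  assumes theta: "0 \<le> \<theta>" "\<theta> \<le> 1"
    and mu: "\<mu> \<in> prob_measures_on (cantor_point \<rho> ` code_set (spaced_positions \<theta>))"
  shows "upper_corr_dim_measure \<mu> \<le> ereal (s * \<theta>)"
proof (cases "\<exists>c>0. \<forall>r>0. c \<le> corr_integral \<mu> r")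
  case True
  then obtain c where c: "0 < c" "\<And>r. 0 < r \<Longrightarrow> c \<le> corr_integral \<mu> r" by blast
  have "\<forall>\<^sub>F r in at_right (0::real). r \<in> {0<..<1}" by (rule eventually_at_right_real) simp
  then have "\<forall>\<^sub>F r in at_right 0. c * r powr 0 \<le> corr_integral \<mu> r"
    by eventually_elim (use c(2) in auto)
  then have "upper_corr_dim_measure \<mu> \<le> ereal 0" by (rule upper_corr_dim_measure_le[OF c(1)])
  also have "\<dots> \<le> ereal (s * \<theta>)" using theta s_pos by simp
  finally show ?thesis .
next
  case False
  define S where "S = spaced_positions \<theta>"
  note closed = prefix_closed_code_set[of S]
  note p = prob_measure_on_image[OF closed mu[folded S_def]]
  interpret prob_space \<mu> by (rule p)
  have small: "\<exists>m0. \<forall>m\<ge>m0. measure \<mu> (cantor_point \<rho> ` (code_set S \<inter> marked m)) \<le> 1/4"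
  proof -
    have "(0::real) < (1/4)^2" by simp
    with False obtain r where r: "0 < r" "corr_integral \<mu> r < (1/4)^2" by (meson not_le)
    obtain n where n: "spread * \<rho> ^ n < r" using rho_power_small[OF r(1)] by blast
    have "measure \<mu> (cantor_point \<rho> ` (code_set S \<inter> marked m)) \<le> 1/4" if "2 ^ n \<le> m" for m
    proof (rule power2_le_imp_le)
      let ?Q = "cantor_point \<rho> ` (code_set S \<inter> marked m) :: 'a set"
      have "(\<Sum>w\<in>{()}. measure \<mu> ?Q^2) \<le> corr_integral \<mu> r"
      proof (rule corr_integral_ge_squares[OF p(1,2)])
        show "?Q \<in> sets borel"
          by (intro borel_cantor_image prefix_closed_Int[OF closed, where n=m]) (rule marked_prefix)
        fix x y assume "x \<in> ?Q" "y \<in> ?Q"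
        then obtain a b where "x = cantor_point \<rho> a" "y = cantor_point \<rho> b" "a \<in> marked m" "b \<in> marked m" by blast
        then have "dist x y \<le> spread * \<rho> ^ n"
          using dist_cantor_point_le[OF marked_agree[OF that], of a b, where 'a='a] by simp
        with n show "dist x y \<le> r" by simp
      qed (auto simp: disjoint_family_on_def)
      then have "measure \<mu> ?Q^2 \<le> corr_integral \<mu> r" by simp
      also have "\<dots> \<le> (1/4)^2" using r(2) by (rule less_imp_le)
      finally show "measure \<mu> ?Q^2 \<le> (1/4)^2" .
    qed simp
    then show ?thesis by blast
  qed
  then obtain m0 where m0: "\<And>m. m0 \<le> m \<Longrightarrow> measure \<mu> (cantor_point \<rho> ` (code_set S \<inter> marked m)) \<le> 1/4" by blast
  have "upper_corr_dim_measure \<mu> \<le> ereal (s * (\<theta> + \<eta>))" if eta: "0 < \<eta>" for \<eta>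
  proof -
    \<comment> \<open>\<open>m0\<close> makes the marked sequences light, and \<open>1 / \<eta>\<close> makes \<open>j!\<close> at most \<open>n \<eta>\<close>.\<close>
    define j0 where "j0 = max m0 (nat \<lceil>1 / \<eta>\<rceil>)"
    show ?thesis
    proof (rule upper_corr_dim_measure_le_of_scales[OF p(1,2), where N = "fact (Suc j0)"])
      show "(0::real) < 1/4" "0 \<le> s * (\<theta> + \<eta>)" using eta theta s_pos by auto
      fix n :: nat assume "fact (Suc j0) \<le> n"
      then obtain j where j: "j0 \<le> j" "fact (Suc j) \<le> n" "n < fact (Suc (Suc j))"
        using factorials_around by blast
      define T where "T = {..<fact j} \<union> (S \<inter> {..<n})"
      have "real (card T) \<le> fact j + real (card (S \<inter> {..<n}))"
        using card_Un_le[of "{..<fact j}" "S \<inter> {..<n}"] unfolding T_def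
        by (metis card_lessThan of_nat_add of_nat_fact of_nat_le_iff)
      also have "\<dots> \<le> real n * \<eta> + real n * \<theta>"
      proof (rule add_mono)
        have "1 / \<eta> \<le> real (Suc j)" using j(1) unfolding j0_def by linarith
        then have "1 \<le> real (Suc j) * \<eta>" using eta by (simp add: field_simps)
        then have "fact j * 1 \<le> fact j * (real (Suc j) * \<eta>)" by (intro mult_left_mono) auto
        also have "\<dots> = real (fact (Suc j)) * \<eta>" by (simp add: algebra_simps)
        also have "\<dots> \<le> real n * \<eta>" using j(2) eta by (intro mult_right_mono) (simp_all only: of_nat_le_iff less_imp_le)
        finally show "fact j \<le> real n * \<eta>" by simp
        show "real (card (S \<inter> {..<n})) \<le> real n * \<theta>" unfolding S_def by (rule card_spaced_positions_le[OF theta])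
      qed
      finally have cardT: "real (card T) \<le> real n * (\<theta> + \<eta>)" by (simp add: algebra_simps)
      let ?R = "cantor_point \<rho> ` {a \<in> code_set S. a \<inter> {..<n} \<in> Pow T} :: 'a set"
      let ?P = "\<lambda>m. cantor_point \<rho> ` (code_set S \<inter> marked m) :: 'a set"
      have meas: "?R \<in> sets \<mu>" "?P m \<in> sets \<mu>" for m
      proof -
        have "prefix_closed (code_set S \<inter> {a. a \<inter> {..<n} \<in> Pow T})"
          by (rule prefix_closed_Int[OF closed, where n=n]) auto
        from borel_cantor_image[OF this] show "?R \<in> sets \<mu>" using p(2) by (simp add: Collect_conj_eq)
        show "?P m \<in> sets \<mu>" unfolding p(2)
          by (intro borel_cantor_image prefix_closed_Int[OF closed, where n=m]) (rule marked_prefix)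
      qed
      have "cantor_point \<rho> ` code_set S \<subseteq> ?R \<union> (?P j \<union> ?P (Suc j))"
      proof
        fix x :: 'a assume "x \<in> cantor_point \<rho> ` code_set S"
        then obtain a where a: "x = cantor_point \<rho> a" "a \<in> code_set S" by blast
        then show "x \<in> ?R \<union> (?P j \<union> ?P (Suc j))"
          using prefix_of_unmarked[OF a(2) _ _ j(3)] unfolding T_def by blast
      qed
      then have "1 \<le> measure \<mu> (?R \<union> (?P j \<union> ?P (Suc j)))"
        unfolding p(3)[symmetric] using meas by (intro finite_measure_mono) auto
      also have "\<dots> \<le> measure \<mu> ?R + (measure \<mu> (?P j) + measure \<mu> (?P (Suc j)))"
        using meas measure_Un_le[of ?R \<mu> "?P j \<union> ?P (Suc j)"]
          measure_Un_le[of "?P j" \<mu> "?P (Suc j)"] by auto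
      also have "\<dots> \<le> measure \<mu> ?R + (1/4 + 1/4)"
        using m0[of j] m0[of "Suc j"] j(1) unfolding j0_def by simp
      finally have "(1/2)^2 \<le> measure \<mu> ?R^2" by (intro power_mono) auto
      also have "\<dots> \<le> card (Pow T) * corr_integral \<mu> (spread * \<rho> ^ n)"
        by (intro corr_integral_ge_words p closed) (simp add: T_def)
      also have "\<dots> = 2 powr card T * corr_integral \<mu> (spread * \<rho> ^ n)"
        by (simp add: card_Pow T_def powr_realpow)
      also have "\<dots> \<le> 2 powr (real n * (\<theta> + \<eta>)) * corr_integral \<mu> (spread * \<rho> ^ n)"
        using cardT by (intro mult_right_mono powr_mono) auto
      finally show "1/4 * (\<rho> ^ n) powr (s * (\<theta> + \<eta>)) \<le> corr_integral \<mu> (spread * \<rho> ^ n)"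
        unfolding rho_power_powr powr_minus by (simp add: field_simps power2_eq_square)
    qed
  qed
  note bound = this
  show ?thesis
  proof (rule ereal_le_epsilon2)
    fix e :: real assume "0 < e"
    then show "upper_corr_dim_measure \<mu> \<le> ereal (s * \<theta>) + ereal e"
      using bound[of "e / s"] s_pos by (simp add: distrib_left)
  qed
qed

lemma coin_measure_on_code_set:
  "coin_measure \<rho> S \<in> prob_measures_on (cantor_point \<rho> ` code_set S :: 'a::euclidean_space set)"
proof -
  let ?E = "cantor_point \<rho> ` code_set S :: 'a set"
  have "{k. f k} \<inter> S \<in> code_set S" for f unfolding code_set_def by blast
  then have "(\<lambda>f. cantor_point \<rho> ({k. f k} \<inter> S)) -` (UNIV - ?E) = {}" by blast
  moreover have "UNIV - ?E \<in> sets borel"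
    using borel_cantor_image[OF prefix_closed_code_set[of S], where 'a='a] by (simp add: Compl_eq_Diff_UNIV[symmetric] borel_comp)
  ultimately have "emeasure (coin_measure \<rho> S) (UNIV - ?E) = 0"
    unfolding coin_measure_def by (subst emeasure_distr[OF measurable_coin_point]) auto
  then show ?thesis
    by (simp add: prob_measures_on_def prob_space_coin_measure sets_coin_measure)
qed

text \<open>The bound of \<open>coin_measure_cball_le\<close> holds for balls around all coded points, and the coin measure
is carried by such points.\<close>

lemma corr_integral_coin_measure_le:
  assumes "r < sep * \<rho> ^ n"
  shows "corr_integral (coin_measure \<rho> S :: 'a::euclidean_space measure) r \<le> (1/2) ^ card (S \<inter> {..<n})"
proof -
  let ?\<mu> = "coin_measure \<rho> S :: 'a measure"
  interpret C: prob_space coin_space by (rule prob_space_coin_space)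
  define g where "g x = measure ?\<mu> (cball x r)" for x
  have int: "integrable ?\<mu> g"
    unfolding g_def by (rule integrable_measure_cball[OF prob_space_coin_measure sets_coin_measure])
  then have g: "g \<in> borel_measurable borel"
    using measurable_cong_sets[OF sets_coin_measure refl, of S] borel_measurable_integrable by blast
  have "corr_integral ?\<mu> r = (\<integral>x. g x \<partial>?\<mu>)" unfolding g_def ..
  also have "\<dots> = (\<integral>f. g (cantor_point \<rho> ({k. f k} \<inter> S)) \<partial>coin_space)"
    unfolding coin_measure_def by (rule integral_distr[OF measurable_coin_point g])
  also have "\<dots> \<le> (\<integral>f. (1/2) ^ card (S \<inter> {..<n}) \<partial>coin_space)"
  proof (rule integral_mono)
    show "integrable coin_space (\<lambda>f. g (cantor_point \<rho> ({k. f k} \<inter> S)))"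
      using int unfolding coin_measure_def integrable_distr_eq[OF measurable_coin_point g] .
    show "g (cantor_point \<rho> ({k. f k} \<inter> S)) \<le> (1/2) ^ card (S \<inter> {..<n})" for f
      unfolding g_def by (rule coin_measure_cball_le[OF assms])
  qed simp
  also have "\<dots> = (1/2) ^ card (S \<inter> {..<n})" using C.prob_space by simp
  finally show ?thesis .
qed

lemma upper_corr_dim_measure_coin_ge:
  assumes theta: "0 \<le> \<theta>" "\<theta> \<le> 1"
  shows "ereal (s * \<theta>) \<le> upper_corr_dim_measure (coin_measure \<rho> (spaced_positions \<theta>) :: 'a::euclidean_space measure)"
proof (rule upper_corr_dim_measure_ge)
  define S where "S = spaced_positions \<theta>"
  let ?\<mu> = "coin_measure \<rho> S :: 'a measure"
  show "0 < 2 * (1 / (sep * \<rho>)) powr (s * \<theta>)" using sep_pos rho by simp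
  have "\<forall>\<^sub>F r in at_right 0. r \<in> {0<..<sep}" by (rule eventually_at_right_real[OF sep_pos])
  then show "\<forall>\<^sub>F r in at_right 0. 0 < corr_integral (coin_measure \<rho> (spaced_positions \<theta>) :: 'a measure) r \<and>
      corr_integral (coin_measure \<rho> (spaced_positions \<theta>) :: 'a measure) r
        \<le> 2 * (1 / (sep * \<rho>)) powr (s * \<theta>) * r powr (s * \<theta>)"
    unfolding S_def[symmetric]
  proof eventually_elim
    case (elim r)
    then obtain n where n: "sep * \<rho> ^ Suc n \<le> r" "r < sep * \<rho> ^ n"
      using scale_between[of r sep] by auto
    have "corr_integral ?\<mu> r \<le> (1/2) ^ card (S \<inter> {..<n})" by (rule corr_integral_coin_measure_le[OF n(2)])
    also have "\<dots> = 2 powr (- real (card (S \<inter> {..<n})))"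
      by (simp add: two_powr_minus_nat)
    also have "\<dots> \<le> 2 powr (1 + - (real n * \<theta>))"
      using card_spaced_positions_ge[OF theta, of n] unfolding S_def by (intro powr_mono) auto
    also have "\<dots> = 2 * (\<rho> ^ n) powr (s * \<theta>)"
      unfolding powr_add rho_power_powr by simp
    also have "\<dots> \<le> 2 * (1 / (sep * \<rho>) * r) powr (s * \<theta>)"
      using n elim rho sep_pos theta s_pos
      by (intro mult_left_mono powr_mono2) (auto simp: field_simps)
    also have "\<dots> = 2 * (1 / (sep * \<rho>)) powr (s * \<theta>) * r powr (s * \<theta>)"
      using elim rho sep_pos powr_mult[of "1 / (sep * \<rho>)" r "s * \<theta>"] by (simp only: mult.assoc)
    finally show ?case
      using corr_integral_pos[OF prefix_closed_code_set coin_measure_on_code_set, of r S, where 'a='a] elim by simp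
  qed
qed

lemma upper_corr_dim_code_set:
  assumes "0 \<le> \<theta>" "\<theta> \<le> 1"
  shows "upper_corr_dim (cantor_point \<rho> ` code_set (spaced_positions \<theta>) :: 'a::euclidean_space set) = ereal (s * \<theta>)"
  unfolding upper_corr_dim_def
proof (rule antisym)
  show "(SUP \<mu>\<in>prob_measures_on (cantor_point \<rho> ` code_set (spaced_positions \<theta>) :: 'a set). upper_corr_dim_measure \<mu>)
      \<le> ereal (s * \<theta>)"
    by (intro SUP_least upper_corr_dim_measure_code_set_le assms)
  have "ereal (s * \<theta>) \<le> upper_corr_dim_measure (coin_measure \<rho> (spaced_positions \<theta>) :: 'a measure)"
    by (rule upper_corr_dim_measure_coin_ge[OF assms])
  also have "\<dots> \<le> (SUP \<mu>\<in>prob_measures_on (cantor_point \<rho> ` code_set (spaced_positions \<theta>) :: 'a set).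
      upper_corr_dim_measure \<mu>)"
    by (rule SUP_upper[OF coin_measure_on_code_set])
  finally show "ereal (s * \<theta>) \<le> (SUP \<mu>\<in>prob_measures_on (cantor_point \<rho> ` code_set (spaced_positions \<theta>) :: 'a set).
      upper_corr_dim_measure \<mu>)" .
qed

end

section \<open>The compact set\<close>

theorem proposition3p3:
  fixes s t :: real
  assumes "0 < t" and "t < s" and "s < 1"
  shows "\<exists>E :: (real ^ 'n) set.
           compact E \<and> upper_corr_dim E = ereal t \<and> packing_dim E = ereal s"
proof -
  define \<rho> where "\<rho> = (1/2 :: real) powr (1 / s)"
  have "\<rho> < (1/2) powr 1"
    unfolding \<rho>_def using assms by (intro powr_less_mono') (auto simp: field_simps)
  then interpret cantor_dim \<rho> s
    by unfold_locales (use assms in \<open>auto simp: \<rho>_def powr_powr\<close>)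
  have theta: "0 \<le> t / s" "t / s \<le> 1" "s * (t / s) = t" using assms by auto
  let ?E = "cantor_point \<rho> ` code_set (spaced_positions (t / s)) :: (real ^ 'n) set"
  have "compact ?E" by (rule compact_cantor_image[OF prefix_closed_code_set])
  moreover have "upper_corr_dim ?E = ereal t"
    using upper_corr_dim_code_set[OF theta(1,2), where 'a="real ^ 'n"] theta(3) by simp
  moreover have "packing_dim ?E = ereal s" by (rule packing_dim_code_set)
  ultimately show ?thesis by blast
qed

end
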